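(* Let $n\ge1$ and let $F_n\colon\bigotimes^3\mathbb{C}^{n^2}\to\mathbb{C}$ be the homogeneous polynomial of degree $n^3$ defined, for $w=\sum_{a,b,c}w_{abc}\,e_a\otimes e_b\otimes e_c$, by $$F_n(w)=\sum_{\alpha,\beta,\gamma\colon[n]^3\to[n^2]}\mathrm{sgn}_x(\alpha)\,\mathrm{sgn}_y(\beta)\,\mathrm{sgn}_z(\gamma)\prod_{p\in[n]^3}w_{\alpha(p)\beta(p)\gamma(p)}.$$ Then $F_n((g_1\otimes g_2\otimes g_3)w)=(\det(g_1)\det(g_2)\det(g_3))^n\,F_n(w)$ for all $(g_1,g_2,g_3)\in\mathrm{GL}_{n^2}^3$ and $w\in\bigotimes^3\mathbb{C}^{n^2}$. Moreover, $F_n\neq0$.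
   Context: $[k]=\{1,\dots,k\}$, and $e_1,\dots,e_{n^2}$ is the standard basis of $\mathbb{C}^{n^2}$. The sum is over all triples of maps (labelings) $[n]^3\to[n^2]$. A total ordering of $[n]^3$ is fixed once and for all. For $\ell\in[n]$, the $\ell$th $x$-slice of $[n]^3$ is $\{(i,j,k)\in[n]^3\mid i=\ell\}$; the $y$-slices and $z$-slices are obtained by fixing the second, respectively third, coordinate. Each slice has $n^2$ elements and inherits an ordering. If a labeling $\alpha$ restricts to a bijection onto $[n^2]$ on each $x$-slice, each restriction is a permutation with a well-defined sign and $\mathrm{sgn}_x(\alpha)\in\{-1,1\}$ is the product of these signs over all $x$-slices; otherwise $\mathrm{sgn}_x(\alpha):=0$. $\mathrm{sgn}_y(\alpha)$ and $\mathrm{sgn}_z(\alpha)$ are defined analogously with $y$- and $z$-slices. *)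

theory Defs
  imports "Jordan_Normal_Form.Determinant" "HOL-Library.FuncSet" Complex_Main
begin

text \<open>
  All index ranges start at 0: the set \<open>[k]\<close> is \<open>{..<k}\<close>, in agreement with the indexing of
  matrices. A tensor \<open>w = (\<Sum>a b c. w a b c \<cdot> e\<^sub>a \<otimes> e\<^sub>b \<otimes> e\<^sub>c)\<close> in the threefold tensor power of
  \<open>\<complex>\<^sup>N\<close> is given by its coordinates, extended by 0 outside the index range.
\<close>

type_synonym tensor = "nat \<Rightarrow> nat \<Rightarrow> nat \<Rightarrow> complex"

definition tensors :: "nat \<Rightarrow> tensor set" where
  "tensors N = {w. \<forall>a b c. \<not> (a < N \<and> b < N \<and> c < N) \<longrightarrow> w a b c = 0}"

text \<open>
  Coordinates of \<open>(g\<^sub>1 \<otimes> g\<^sub>2 \<otimes> g\<^sub>3) w\<close>. As \<open>g e\<^sub>a\<close> is the \<open>a\<close>-th column of \<open>g\<close>, this is the linear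
  map sending \<open>e\<^sub>a \<otimes> e\<^sub>b \<otimes> e\<^sub>c\<close> to \<open>g\<^sub>1 e\<^sub>a \<otimes> g\<^sub>2 e\<^sub>b \<otimes> g\<^sub>3 e\<^sub>c\<close>.
\<close>

definition tensor_act ::
    "nat \<Rightarrow> complex mat \<Rightarrow> complex mat \<Rightarrow> complex mat \<Rightarrow> tensor \<Rightarrow> tensor" where
  "tensor_act N g1 g2 g3 w = (\<lambda>a b c.
     if a < N \<and> b < N \<and> c < N
     then \<Sum>a'<N. \<Sum>b'<N. \<Sum>c'<N. g1 $$ (a, a') * g2 $$ (b, b') * g3 $$ (c, c') * w a' b' c'
     else 0)"

definition cube :: "nat \<Rightarrow> (nat \<times> nat \<times> nat) set" where
  "cube n = {..<n} \<times> {..<n} \<times> {..<n}"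

definition x_slice :: "nat \<Rightarrow> nat \<Rightarrow> (nat \<times> nat \<times> nat) set" where
  "x_slice n l = {(i, j, k) \<in> cube n. i = l}"

definition y_slice :: "nat \<Rightarrow> nat \<Rightarrow> (nat \<times> nat \<times> nat) set" where
  "y_slice n l = {(i, j, k) \<in> cube n. j = l}"

definition z_slice :: "nat \<Rightarrow> nat \<Rightarrow> (nat \<times> nat \<times> nat) set" where
  "z_slice n l = {(i, j, k) \<in> cube n. k = l}"

definition labelings :: "nat \<Rightarrow> (nat \<times> nat \<times> nat \<Rightarrow> nat) set" where
  "labelings n = cube n \<rightarrow>\<^sub>E {..<n\<^sup>2}"

text \<open>
  For a total ordering \<open>r\<close> (reflexive, with \<open>(s, t) \<in> r\<close> meaning \<open>s \<le> t\<close>) of a set containing the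
  finite set \<open>S\<close>, \<open>rank_in r S\<close> is the order isomorphism from \<open>S\<close> onto \<open>{..<card S}\<close>. Its inverse
  lists \<open>S\<close> in increasing order, which turns a bijection \<open>\<alpha>\<close> from \<open>S\<close> onto \<open>{..<card S}\<close> into a
  permutation of \<open>{..<card S}\<close>; the latter is continued by the identity because \<^const>\<open>sign\<close> is
  defined for permutations of the whole type.
\<close>

definition rank_in :: "('a \<times> 'a) set \<Rightarrow> 'a set \<Rightarrow> 'a \<Rightarrow> nat" where
  "rank_in r S s = card {t \<in> S. (t, s) \<in> r \<and> t \<noteq> s}"

definition bij_sign :: "('a \<times> 'a) set \<Rightarrow> 'a set \<Rightarrow> ('a \<Rightarrow> nat) \<Rightarrow> int" where
  "bij_sign r S \<alpha> =
     sign (\<lambda>i. if i < card S then \<alpha> (inv_into S (rank_in r S) i) else i)"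

definition slices_sgn ::
    "((nat \<times> nat \<times> nat) \<times> (nat \<times> nat \<times> nat)) set \<Rightarrow> nat \<Rightarrow> (nat \<Rightarrow> (nat \<times> nat \<times> nat) set)
      \<Rightarrow> (nat \<times> nat \<times> nat \<Rightarrow> nat) \<Rightarrow> int" where
  "slices_sgn r n slice \<alpha> =
     (if \<forall>l<n. bij_betw \<alpha> (slice l) {..<n\<^sup>2} then \<Prod>l<n. bij_sign r (slice l) \<alpha> else 0)"

definition sgn_x where "sgn_x r n = slices_sgn r n (x_slice n)"

definition sgn_y where "sgn_y r n = slices_sgn r n (y_slice n)"

definition sgn_z where "sgn_z r n = slices_sgn r n (z_slice n)"

definition F ::
    "((nat \<times> nat \<times> nat) \<times> (nat \<times> nat \<times> nat)) set \<Rightarrow> nat \<Rightarrow> tensor \<Rightarrow> complex" where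
  "F r n w =
     (\<Sum>\<alpha>\<in>labelings n. \<Sum>\<beta>\<in>labelings n. \<Sum>\<gamma>\<in>labelings n.
        of_int (sgn_x r n \<alpha>) * of_int (sgn_y r n \<beta>) * of_int (sgn_z r n \<gamma>)
          * (\<Prod>p\<in>cube n. w (\<alpha> p) (\<beta> p) (\<gamma> p)))"

lemma card_cube: "card (cube n) = n ^ 3"
  by (simp add: cube_def card_cartesian_product power3_eq_cube)

lemma F_homogeneous: "F r n (\<lambda>a b c. t * w a b c) = t ^ (n ^ 3) * F r n w"
  by (simp add: F_def prod.distrib card_cube sum_distrib_left mult_ac)

end

theory Submission
  imports Defs
begin

text \<open>
  Fix one of the three directions. The index \<open>u p\<close> of the slice through \<open>p\<close> and a numbering \<open>v p\<close> of
  the positions inside the slices identify the cube with the grid \<open>{..<n} \<times> {..<n\<^sup>2}\<close>. For a pair of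
  maps \<open>f, \<alpha>\<close> let \<open>E(f, \<alpha>)\<close> be the sign of the bijection \<open>p \<mapsto> (f p, \<alpha> p)\<close> onto this grid, compared
  with the reference bijection \<open>(u, v)\<close>, and \<open>0\<close> if it is not a bijection. Up to one global sign, which
  absorbs the ordering of the cube, the slice sign of a labeling \<open>\<alpha>\<close> is \<open>E(u, \<alpha>)\<close>
  (\<open>slices_sgn_eq_rel_sign\<close>). Everything follows from the behaviour of \<open>E\<close>.

  \<^emph>\<open>Covariance.\<close> As a function of either argument, \<open>E\<close> is, up to sign, a product of determinants
  over the fibres of the other one. Hence summing \<open>E\<close> against products of entries of a matrix \<open>g\<close> multiplies it by a power
  of \<open>det g\<close> (\<open>sum_grid_sign_action\<close>). After expansion of \<open>(g\<^sub>1 \<otimes> g\<^sub>2 \<otimes> g\<^sub>3) w\<close> the sum factors into three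
  such sums, one for each direction.

  \<^emph>\<open>Nonvanishing.\<close> If \<open>F\<close> vanished, so would the coefficients of its monomials. Moving a permutation
  from one argument of \<open>E\<close> to the other, \<open>E(u, v \<circ> \<sigma>) = sign \<sigma> \<cdot> E(u \<circ> \<sigma>\<^sup>-\<^sup>1, v)\<close>, turns some of these
  coefficients, up to sign, into the numbers
  \<open>\<Sum>\<^sub>\<pi> sign \<pi> \<cdot> D\<^sub>x(x \<circ> \<pi> \<circ> \<rho>\<^sub>1) \<cdot> D\<^sub>y(y \<circ> \<pi> \<circ> \<rho>\<^sub>2) \<cdot> D\<^sub>z(z \<circ> \<pi> \<circ> \<rho>\<^sub>3)\<close>,
  where \<open>\<pi>\<close> runs over the permutations of the cube and \<open>D(f) = E(f, v)\<close> is a product of \<open>n\<^sup>2\<close>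
  determinants of size \<open>n\<close>, one for each position inside the slices. Such a sum pairs a product of
  determinants with the generator of the top exterior power of \<open>\<complex>\<^sup>n \<otimes> \<complex>\<^sup>n \<otimes> \<complex>\<^sup>n\<close>. This generator is
  invariant under the special linear group of each factor, and multilinear invariants of the special
  linear group are spanned by products of determinants, so the generator cannot be orthogonal to all of
  them. The lemma \<open>stabilizer_sum_eq_0\<close> makes this precise for one factor: if an invariant is
  orthogonal to all \<open>D(_ \<circ> \<rho>)\<close>, then its value at \<open>u\<close> is \<open>0\<close>. Applied to the three factors in turn, it
  restricts the alternating sum to the permutations that fix the first, then the second, then the third
  coordinate. Only the identity remains, and it contributes \<open>1\<close>, a contradiction.
\<close>

section \<open>The sign of a bijection relative to a reference bijection\<close>

text \<open>
  The sign of the permutation \<open>\<pi>\<close> of \<open>A\<close> with \<open>\<phi> = \<theta> \<circ> \<pi>\<close> on \<open>A\<close>. Only bijections onto \<open>\<theta> ` A\<close> have such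
  a permutation; the value \<open>0\<close> for all other maps makes this the determinant of the \<open>0\<close>-\<open>1\<close> matrix with
  entries \<open>\<phi> p = \<theta> q\<close> whenever \<open>\<phi>\<close> maps \<open>A\<close> into \<open>\<theta> ` A\<close>.
\<close>

definition rel_sign :: "'a set \<Rightarrow> ('a \<Rightarrow> 'b) \<Rightarrow> ('a \<Rightarrow> 'b) \<Rightarrow> int" where
  "rel_sign A \<theta> \<phi> = (if bij_betw \<phi> A (\<theta> ` A) then sign_on A (inv_into A \<theta> \<circ> \<phi>) else 0)"

lemma rel_sign_cong:
  assumes "\<And>p. p \<in> A \<Longrightarrow> \<phi> p = \<psi> p"
  shows "rel_sign A \<theta> \<phi> = rel_sign A \<theta> \<psi>"
proof -
  have "bij_betw \<phi> A (\<theta> ` A) = bij_betw \<psi> A (\<theta> ` A)"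
    using assms by (rule bij_betw_cong)
  moreover have "sign_on A (inv_into A \<theta> \<circ> \<phi>) = sign_on A (inv_into A \<theta> \<circ> \<psi>)"
    using assms by (intro sign_on_cong) auto
  ultimately show ?thesis by (simp add: rel_sign_def)
qed

lemma rel_sign_eq_sign:
  assumes "inj_on \<theta> A" "\<pi> permutes A" "\<And>p. p \<in> A \<Longrightarrow> \<phi> p = \<theta> (\<pi> p)"
  shows "rel_sign A \<theta> \<phi> = sign \<pi>"
proof -
  have "bij_betw (\<lambda>p. \<theta> (\<pi> p)) A (\<theta> ` A)"
    using bij_betw_trans[OF permutes_imp_bij[OF assms(2)] inj_on_imp_bij_betw[OF assms(1)]]
    by (simp add: o_def)
  hence "bij_betw \<phi> A (\<theta> ` A)"
    using assms(3) by (subst bij_betw_cong[of A \<phi> "\<lambda>p. \<theta> (\<pi> p)"]) auto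
  moreover have "sign_on A (inv_into A \<theta> \<circ> \<phi>) = sign_on A \<pi>"
    using assms by (intro sign_on_cong) (auto simp: permutes_in_image)
  ultimately show ?thesis
    using sign_on_permutes[OF assms(2)] by (simp add: rel_sign_def)
qed

lemma rel_sign_refl: "inj_on \<theta> A \<Longrightarrow> rel_sign A \<theta> \<theta> = 1"
  using rel_sign_eq_sign[of \<theta> A id \<theta>] by (simp add: permutes_id)

lemma rel_sign_nonzero_obtains:
  assumes "inj_on \<theta> A" "bij_betw \<phi> A (\<theta> ` A)"
  obtains \<pi> where "\<pi> permutes A" "\<And>p. p \<in> A \<Longrightarrow> \<phi> p = \<theta> (\<pi> p)"
proof
  have "bij_betw (inv_into A \<theta> \<circ> \<phi>) A A"
    using assms by (meson bij_betw_inv_into bij_betw_trans inj_on_imp_bij_betw)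
  thus "restrict_id (inv_into A \<theta> \<circ> \<phi>) A permutes A"
    by (rule permutes_restrict_id)
  show "\<phi> p = \<theta> (restrict_id (inv_into A \<theta> \<circ> \<phi>) A p)" if "p \<in> A" for p
    using that assms(2) by (auto simp: f_inv_into_f bij_betw_apply)
qed

lemma rel_sign_permute:
  assumes "finite A" "inj_on \<theta> A" "\<sigma> permutes A"
  shows "rel_sign A \<theta> (\<lambda>p. \<phi> (\<sigma> p)) = sign \<sigma> * rel_sign A \<theta> \<phi>"
proof (cases "bij_betw \<phi> A (\<theta> ` A)")
  case True
  then obtain \<pi> where \<pi>: "\<pi> permutes A" "\<And>p. p \<in> A \<Longrightarrow> \<phi> p = \<theta> (\<pi> p)"
    using rel_sign_nonzero_obtains[OF assms(2)] by blast
  have "rel_sign A \<theta> (\<lambda>p. \<phi> (\<sigma> p)) = sign (\<pi> \<circ> \<sigma>)"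
    using assms \<pi> by (intro rel_sign_eq_sign permutes_compose) (auto simp: permutes_in_image)
  also have "\<dots> = sign \<sigma> * sign \<pi>"
    using assms \<pi> by (subst sign_compose) (auto simp: permutes_imp_permutation)
  finally show ?thesis using rel_sign_eq_sign[OF assms(2) \<pi>] by simp
next
  case False
  have "\<not> bij_betw (\<lambda>p. \<phi> (\<sigma> p)) A (\<theta> ` A)"
  proof
    assume "bij_betw (\<lambda>p. \<phi> (\<sigma> p)) A (\<theta> ` A)"
    from bij_betw_trans[OF permutes_imp_bij[OF permutes_inv[OF assms(3)]] this]
    have "bij_betw \<phi> A (\<theta> ` A)"
      using permutes_inverses[OF assms(3)] by (simp add: o_def)
    with False show False by simp
  qed
  with False show ?thesis by (simp add: rel_sign_def)
qed

text \<open>A change of the reference bijection costs only a global factor.\<close>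

lemma rel_sign_trans:
  assumes "finite A" "inj_on \<theta> A" "bij_betw \<theta>' A (\<theta> ` A)"
  shows "rel_sign A \<theta> \<phi> = rel_sign A \<theta> \<theta>' * rel_sign A \<theta>' \<phi>"
proof (cases "bij_betw \<phi> A (\<theta> ` A)")
  case True
  have im: "\<theta>' ` A = \<theta> ` A" and inj': "inj_on \<theta>' A" using assms(3) by (auto simp: bij_betw_def)
  obtain \<pi> where \<pi>: "\<pi> permutes A" "\<And>p. p \<in> A \<Longrightarrow> \<phi> p = \<theta>' (\<pi> p)"
    using rel_sign_nonzero_obtains[OF inj', of \<phi>] True im by auto
  have "rel_sign A \<theta> \<phi> = rel_sign A \<theta> (\<lambda>p. \<theta>' (\<pi> p))"
    using \<pi> by (intro rel_sign_cong)
  also have "\<dots> = sign \<pi> * rel_sign A \<theta> \<theta>'"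
    by (rule rel_sign_permute[OF assms(1,2) \<pi>(1)])
  finally show ?thesis using rel_sign_eq_sign[OF inj' \<pi>] by simp
next
  case False
  have "\<theta>' ` A = \<theta> ` A" using assms(3) by (auto simp: bij_betw_def)
  with False show ?thesis by (simp add: rel_sign_def)
qed

text \<open>This allows the two coordinates of a grid to be exchanged.\<close>

lemma rel_sign_image:
  assumes "inj h" "inj_on \<theta> A"
  shows "rel_sign A (\<lambda>p. h (\<theta> p)) (\<lambda>p. h (\<phi> p)) = rel_sign A \<theta> \<phi>"
proof (cases "bij_betw \<phi> A (\<theta> ` A)")
  case True
  then obtain \<pi> where \<pi>: "\<pi> permutes A" "\<And>p. p \<in> A \<Longrightarrow> \<phi> p = \<theta> (\<pi> p)"
    using rel_sign_nonzero_obtains[OF assms(2)] by blast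
  have "inj_on (\<lambda>p. h (\<theta> p)) A" using assms by (auto simp: inj_on_def)
  hence "rel_sign A (\<lambda>p. h (\<theta> p)) (\<lambda>p. h (\<phi> p)) = sign \<pi>"
    using \<pi> by (intro rel_sign_eq_sign) auto
  thus ?thesis using rel_sign_eq_sign[OF assms(2) \<pi>] by simp
next
  case False
  have "\<not> bij_betw (\<lambda>p. h (\<phi> p)) A ((\<lambda>p. h (\<theta> p)) ` A)"
  proof
    assume *: "bij_betw (\<lambda>p. h (\<phi> p)) A ((\<lambda>p. h (\<theta> p)) ` A)"
    have "inj_on \<phi> A" using * by (auto simp: bij_betw_def inj_on_def)
    moreover have "h ` (\<phi> ` A) = h ` (\<theta> ` A)" using * by (auto simp: bij_betw_def image_image)
    hence "\<phi> ` A = \<theta> ` A" using assms(1) by (simp add: inj_image_eq_iff)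
    ultimately show False using False by (simp add: bij_betw_def)
  qed
  with False show ?thesis by (simp add: rel_sign_def)
qed

text \<open>
  A permutation that preserves all fibres of \<open>v\<close> is the commuting product of its restrictions to them.
\<close>

lemma sign_on_fibres:
  assumes "finite A" "\<pi> permutes A" "\<And>p. p \<in> A \<Longrightarrow> v (\<pi> p) = v p" "finite L"
  shows "sign_on {p \<in> A. v p \<in> L} \<pi> = (\<Prod>l\<in>L. sign_on {p \<in> A. v p = l} \<pi>)"
  using assms(4)
proof induction
  case empty
  have "restrict_id \<pi> {} = id" by (auto simp: restrict_id_def)
  thus ?case by (simp add: sign_on_def)
next
  case (insert l L)
  have bij: "bij_betw \<pi> {p \<in> A. v p \<in> M} {p \<in> A. v p \<in> M}" for M
  proof (rule bij_betw_imageI)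
    show "inj_on \<pi> {p \<in> A. v p \<in> M}"
      using permutes_inj_on[OF assms(2)] .
    have "\<pi> ` {p \<in> A. v p \<in> M} \<subseteq> {p \<in> A. v p \<in> M}"
      using assms by (auto simp: permutes_in_image)
    thus "\<pi> ` {p \<in> A. v p \<in> M} = {p \<in> A. v p \<in> M}"
      using assms(1) permutes_inj_on[OF assms(2)] by (intro endo_inj_surj) auto
  qed
  have perm: "permutation (restrict_id \<pi> {p \<in> A. v p \<in> M})" for M
    using assms(1) by (intro permutes_imp_permutation[OF _ permutes_restrict_id[OF bij]]) auto
  have "restrict_id \<pi> {p \<in> A. v p \<in> insert l L}
      = restrict_id \<pi> {p \<in> A. v p \<in> {l}} \<circ> restrict_id \<pi> {p \<in> A. v p \<in> L}"
    using insert.hyps assms(2,3) by (auto simp: restrict_id_def fun_eq_iff permutes_in_image)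
  hence "sign_on {p \<in> A. v p \<in> insert l L} \<pi>
      = sign_on {p \<in> A. v p \<in> {l}} \<pi> * sign_on {p \<in> A. v p \<in> L} \<pi>"
    unfolding sign_on_def by (simp only: sign_compose[OF perm perm])
  also have "\<dots> = sign_on {p \<in> A. v p = l} \<pi> * (\<Prod>l\<in>L. sign_on {p \<in> A. v p = l} \<pi>)"
    using insert.IH by simp
  finally show ?case using insert.hyps by simp
qed

section \<open>Signs and determinants on a grid\<close>

text \<open>
  A finite set with coordinates \<open>u\<close> (column) and \<open>v\<close> (row) that identify it with a rectangle. Columns
  are numbered because column labels will index matrices; rows may be labelled arbitrarily.
\<close>

locale grid =
  fixes A :: "'a set" and u :: "'a \<Rightarrow> nat" and v :: "'a \<Rightarrow> 'l" and n :: nat and L :: "'l set"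
  assumes finite_A: "finite A" and finite_L: "finite L"
    and bij: "bij_betw (\<lambda>p. (u p, v p)) A ({..<n} \<times> L)"
begin

abbreviation grid_sign :: "('a \<Rightarrow> nat) \<Rightarrow> ('a \<Rightarrow> 'l) \<Rightarrow> int" where
  "grid_sign f \<alpha> \<equiv> rel_sign A (\<lambda>p. (u p, v p)) (\<lambda>p. (f p, \<alpha> p))"

definition cell :: "nat \<Rightarrow> 'l \<Rightarrow> 'a" where
  "cell i l = inv_into A (\<lambda>p. (u p, v p)) (i, l)"

lemma inj: "inj_on (\<lambda>p. (u p, v p)) A"
  and image: "(\<lambda>p. (u p, v p)) ` A = {..<n} \<times> L"
  using bij by (auto simp: bij_betw_def)

lemma u_less: "p \<in> A \<Longrightarrow> u p < n" and v_in: "p \<in> A \<Longrightarrow> v p \<in> L"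
  using image by auto

lemma cell: "i < n \<Longrightarrow> l \<in> L \<Longrightarrow> cell i l \<in> A \<and> u (cell i l) = i \<and> v (cell i l) = l"
  using f_inv_into_f[of "(i, l)" "\<lambda>p. (u p, v p)" A] inv_into_into[of "(i, l)" "\<lambda>p. (u p, v p)" A] image
  by (auto simp: cell_def)

lemma cell_eq: "p \<in> A \<Longrightarrow> cell (u p) (v p) = p"
  using inv_into_f_f[OF inj] by (simp add: cell_def)

lemma grid_eqI: "p \<in> A \<Longrightarrow> q \<in> A \<Longrightarrow> u p = u q \<Longrightarrow> v p = v q \<Longrightarrow> p = q"
  by (metis cell_eq)

lemma prod_grid: "(\<Prod>p\<in>A. h (u p) (v p)) = (\<Prod>l\<in>L. \<Prod>i<n. h i l)"
proof -
  have "(\<Prod>p\<in>A. h (u p) (v p)) = (\<Prod>(i, l)\<in>{..<n} \<times> L. h i l)"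
    using prod.reindex_bij_betw[OF bij, of "\<lambda>(i, l). h i l"] by simp
  also have "\<dots> = (\<Prod>i<n. \<Prod>l\<in>L. h i l)"
    by (simp add: prod.cartesian_product)
  finally show ?thesis by (subst prod.swap)
qed

lemma row_bij:
  assumes "l \<in> L"
  shows "bij_betw u {p \<in> A. v p = l} {..<n}"
proof (rule bij_betw_imageI)
  show "inj_on u {p \<in> A. v p = l}" by (auto simp: inj_on_def intro: grid_eqI)
  have "i \<in> u ` {p \<in> A. v p = l}" if "i < n" for i
    by (rule image_eqI[of _ _ "cell i l"]) (use cell[OF that assms] in auto)
  thus "u ` {p \<in> A. v p = l} = {..<n}" using u_less by auto
qed

text \<open>
  A bijection onto the grid that keeps the row label permutes each row separately, so its sign is the
  product of the signs of these row permutations.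
\<close>

lemma grid_sign_rows:
  assumes "\<And>l. l \<in> L \<Longrightarrow> \<psi> l permutes {..<n}"
  shows "grid_sign (\<lambda>p. \<psi> (v p) (u p)) v = (\<Prod>l\<in>L. sign (\<psi> l))"
proof -
  define \<pi> where "\<pi> = restrict_id (\<lambda>p. cell (\<psi> (v p) (u p)) (v p)) A"
  have \<psi>_less: "\<psi> (v p) (u p) < n" if "p \<in> A" for p
    using permutes_in_image[OF assms[OF v_in[OF that]], of "u p"] u_less[OF that] by simp
  have c: "\<pi> p \<in> A" "u (\<pi> p) = \<psi> (v p) (u p)" "v (\<pi> p) = v p" if "p \<in> A" for p
    using cell[OF \<psi>_less[OF that] v_in[OF that]] that by (simp_all add: \<pi>_def)
  have inj\<pi>: "inj_on \<pi> A"
  proof (rule inj_onI)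
    fix p q assume pq: "p \<in> A" "q \<in> A" and eq: "\<pi> p = \<pi> q"
    have v: "v p = v q" using c(3) pq eq by metis
    have "\<psi> (v p) (u p) = \<psi> (v p) (u q)" using c(2) pq eq v by metis
    hence "u p = u q"
      using permutes_inj[OF assms[OF v_in[OF pq(1)]]] by (simp add: inj_eq)
    with v show "p = q" using pq by (intro grid_eqI)
  qed
  have "bij_betw \<pi> A A"
    using inj\<pi> finite_A c(1) by (intro bij_betw_imageI endo_inj_surj) auto
  hence \<pi>: "\<pi> permutes A"
    using permutes_restrict_id[of \<pi> A] by (simp add: \<pi>_def restrict_id_def if_distrib cong: if_cong)
  have "grid_sign (\<lambda>p. \<psi> (v p) (u p)) v = sign \<pi>"
    using c by (intro rel_sign_eq_sign inj \<pi>) simp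
  also have "\<dots> = sign_on A \<pi>"
    using sign_on_permutes[OF \<pi>] by simp
  also have "\<dots> = sign_on {p \<in> A. v p \<in> L} \<pi>"
    using v_in by (intro arg_cong2[where f = sign_on]) auto
  also have "\<dots> = (\<Prod>l\<in>L. sign_on {p \<in> A. v p = l} \<pi>)"
    using c by (intro sign_on_fibres finite_A finite_L \<pi>)
  also have "\<dots> = (\<Prod>l\<in>L. sign (\<psi> l))"
  proof (rule prod.cong[OF refl])
    fix l assume l: "l \<in> L"
    let ?R = "{p \<in> A. v p = l}"
    have r: "restrict_id \<pi> ?R permutes ?R"
    proof (rule permutes_restrict_id, rule bij_betw_imageI)
      show *: "inj_on \<pi> ?R" using inj\<pi> by (rule inj_on_subset) auto
      show "\<pi> ` ?R = ?R"
        using * finite_A c by (intro endo_inj_surj) auto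
    qed
    have "map_permutation ?R u (restrict_id \<pi> ?R) = \<psi> l"
    proof
      fix i
      show "map_permutation ?R u (restrict_id \<pi> ?R) i = \<psi> l i"
      proof (cases "i < n")
        case True
        have "map_permutation ?R u (restrict_id \<pi> ?R) (u (cell i l)) = u (restrict_id \<pi> ?R (cell i l))"
          using row_bij[OF l] cell[OF True l] by (intro map_permutation_apply) (auto simp: bij_betw_def)
        thus ?thesis using cell[OF True l] c[of "cell i l"] by simp
      next
        case False
        thus ?thesis using permutes_not_in[OF assms[OF l]] row_bij[OF l]
          by (simp add: map_permutation_def bij_betw_def)
      qed
    qed
    thus "sign_on ?R \<pi> = sign (\<psi> l)"
      using sign_map_permutation[OF _ r, of u] row_bij[OF l] finite_A
      by (auto simp: sign_on_def bij_betw_def)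
  qed
  finally show ?thesis .
qed

text \<open>
  The nonzero terms come from the maps \<open>f\<close> that permute each row of the grid. They correspond to
  families of permutations of \<open>{..<n}\<close> indexed by the rows, and the sum factors into one Leibniz
  expansion of \<open>det g\<close> for each row.
\<close>

lemma sum_grid_sign_eq_det_pow:
  fixes g :: "complex mat"
  assumes g: "g \<in> carrier_mat n n"
  shows "(\<Sum>f\<in>A \<rightarrow>\<^sub>E {..<n}. of_int (grid_sign f v) * (\<Prod>p\<in>A. g $$ (u p, f p))) = det g ^ card L"
proof -
  let ?P = "{q. q permutes {..<n}}"
  let ?fun = "\<lambda>\<psi>. restrict (\<lambda>p. \<psi> (v p) (u p)) A"
  let ?s = "\<lambda>f. of_int (grid_sign f v) * (\<Prod>p\<in>A. g $$ (u p, f p))"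
  have "det g ^ card L = (\<Prod>l\<in>L. \<Sum>q\<in>?P. of_int (sign q) * (\<Prod>i<n. g $$ (i, q i)))"
    by (simp add: det_def'[OF g] atLeast0LessThan)
  also have "\<dots> = (\<Sum>\<psi>\<in>PiE L (\<lambda>_. ?P). \<Prod>l\<in>L. of_int (sign (\<psi> l)) * (\<Prod>i<n. g $$ (i, \<psi> l i)))"
    by (intro prod_sum_PiE finite_L finite_permutations) auto
  also have "\<dots> = (\<Sum>\<psi>\<in>PiE L (\<lambda>_. ?P). ?s (?fun \<psi>))"
  proof (rule sum.cong[OF refl])
    fix \<psi> assume \<psi>: "\<psi> \<in> PiE L (\<lambda>_. ?P)"
    have "grid_sign (?fun \<psi>) v = grid_sign (\<lambda>p. \<psi> (v p) (u p)) v"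
      by (rule rel_sign_cong) simp
    also have "\<dots> = (\<Prod>l\<in>L. sign (\<psi> l))"
      using \<psi> by (intro grid_sign_rows) auto
    finally show "(\<Prod>l\<in>L. of_int (sign (\<psi> l)) * (\<Prod>i<n. g $$ (i, \<psi> l i))) = ?s (?fun \<psi>)"
      using prod_grid[of "\<lambda>i l. g $$ (i, \<psi> l i)"] by (simp add: prod.distrib of_int_prod)
  qed
  also have "\<dots> = sum ?s (?fun ` PiE L (\<lambda>_. ?P))"
  proof (rule sum.reindex[symmetric, unfolded o_def], rule inj_onI)
    fix \<psi> \<chi> assume *: "\<psi> \<in> PiE L (\<lambda>_. ?P)" "\<chi> \<in> PiE L (\<lambda>_. ?P)" and eq: "?fun \<psi> = ?fun \<chi>"
    show "\<psi> = \<chi>"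
    proof (rule PiE_ext[OF *])
      fix l assume l: "l \<in> L"
      show "\<psi> l = \<chi> l"
      proof
        fix i
        show "\<psi> l i = \<chi> l i"
        proof (cases "i < n")
          case True
          thus ?thesis using fun_cong[OF eq, of "cell i l"] cell[OF True l] by simp
        next
          case False
          have "\<psi> l permutes {..<n}" "\<chi> l permutes {..<n}" using * l by auto
          thus ?thesis using False by (simp add: permutes_not_in)
        qed
      qed
    qed
  qed
  also have "\<dots> = sum ?s (A \<rightarrow>\<^sub>E {..<n})"
  proof (rule sum.mono_neutral_left)
    show "finite (A \<rightarrow>\<^sub>E {..<n})" using finite_A by (intro finite_PiE) auto
    show "?fun ` PiE L (\<lambda>_. ?P) \<subseteq> A \<rightarrow>\<^sub>E {..<n}"
    proof (intro image_subsetI PiE_I)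
      fix \<psi> p assume \<psi>: "\<psi> \<in> PiE L (\<lambda>_. ?P)" and p: "p \<in> A"
      have "\<psi> (v p) permutes {..<n}" using \<psi> v_in[OF p] by auto
      from permutes_in_image[OF this, of "u p"] show "?fun \<psi> p \<in> {..<n}"
        using u_less[OF p] p by simp
    qed auto
    show "\<forall>f\<in>(A \<rightarrow>\<^sub>E {..<n}) - ?fun ` PiE L (\<lambda>_. ?P). ?s f = 0"
    proof (rule ballI, rule ccontr)
      fix f assume f: "f \<in> (A \<rightarrow>\<^sub>E {..<n}) - ?fun ` PiE L (\<lambda>_. ?P)" and "?s f \<noteq> 0"
      hence "inj_on (\<lambda>p. (f p, v p)) A"
        by (auto simp: rel_sign_def bij_betw_def split: if_splits)
      hence inj_f: "p = q" if "p \<in> A" "q \<in> A" "f p = f q" "v p = v q" for p q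
        using that by (auto simp: inj_on_def)
      define \<psi> where "\<psi> = restrict (\<lambda>l. restrict_id (\<lambda>i. f (cell i l)) {..<n}) L"
      have "bij_betw (\<lambda>i. f (cell i l)) {..<n} {..<n}" if l: "l \<in> L" for l
      proof -
        have "inj_on (\<lambda>i. f (cell i l)) {..<n}"
        proof (rule inj_onI)
          fix i j assume "i \<in> {..<n}" "j \<in> {..<n}" "f (cell i l) = f (cell j l)"
          thus "i = j" using inj_f[of "cell i l" "cell j l"] cell[OF _ l] by (metis lessThan_iff)
        qed
        moreover have "(\<lambda>i. f (cell i l)) ` {..<n} \<subseteq> {..<n}"
          using f cell[OF _ l] by auto
        ultimately show ?thesis by (intro bij_betw_imageI endo_inj_surj) auto
      qed
      hence "\<psi> \<in> PiE L (\<lambda>_. ?P)"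
        by (auto simp: \<psi>_def intro: permutes_restrict_id)
      moreover have "f = ?fun \<psi>"
      proof
        fix p show "f p = ?fun \<psi> p"
          using f by (cases "p \<in> A") (auto simp: \<psi>_def v_in u_less cell_eq)
      qed
      ultimately show False using f by auto
    qed
  qed
  finally show ?thesis by simp
qed

end

lemma sum_PiE_permute:
  assumes "\<sigma> permutes A"
  shows "(\<Sum>f\<in>A \<rightarrow>\<^sub>E B. h (\<lambda>p. f (\<sigma> p))) = (\<Sum>f\<in>A \<rightarrow>\<^sub>E B. h f)"
proof (rule sum.reindex_bij_witness[where i = "\<lambda>f p. f (inv_into UNIV \<sigma> p)" and j = "\<lambda>f p. f (\<sigma> p)"])
  fix f assume f: "f \<in> A \<rightarrow>\<^sub>E B"
  have "(\<lambda>p. f (\<tau> p)) \<in> A \<rightarrow>\<^sub>E B" if "\<tau> permutes A" for \<tau>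
    using f permutes_in_image[OF that] by (auto simp: PiE_def extensional_def permutes_not_in[OF that])
  thus "(\<lambda>p. f (\<sigma> p)) \<in> A \<rightarrow>\<^sub>E B" "(\<lambda>p. f (inv_into UNIV \<sigma> p)) \<in> A \<rightarrow>\<^sub>E B"
    using assms permutes_inv by blast+
qed (simp_all add: permutes_inverses[OF assms])

context grid
begin

lemma card_A: "card A = card ({..<n} \<times> L)"
  using bij_betw_same_card[OF bij] .

text \<open>
  If \<open>(f\<^sub>0, \<alpha>)\<close> is a bijection onto the grid, it may serve as the reference bijection, which reduces the
  claim to the previous lemma. Otherwise either \<open>\<alpha>\<close> leaves \<open>L\<close> and all signs are \<open>0\<close>, or \<open>(f\<^sub>0, \<alpha>)\<close> takes
  the same value at two distinct points. Exchanging these points preserves the monomials but reverses the sign, so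
  the sum vanishes: this is a determinant with two equal rows.
\<close>

lemma sum_grid_sign_action:
  fixes g :: "complex mat"
  assumes g: "g \<in> carrier_mat n n" and f\<^sub>0: "f\<^sub>0 \<in> A \<rightarrow> {..<n}"
  shows "(\<Sum>f\<in>A \<rightarrow>\<^sub>E {..<n}. of_int (grid_sign f \<alpha>) * (\<Prod>p\<in>A. g $$ (f\<^sub>0 p, f p)))
    = det g ^ card L * of_int (grid_sign f\<^sub>0 \<alpha>)"
    (is "sum ?s _ = _")
proof (cases "bij_betw (\<lambda>p. (f\<^sub>0 p, \<alpha> p)) A ({..<n} \<times> L)")
  case True
  interpret G: grid A f\<^sub>0 \<alpha> n L
    using True finite_A finite_L by unfold_locales
  have trans: "grid_sign f \<alpha> = grid_sign f\<^sub>0 \<alpha> * G.grid_sign f \<alpha>" for f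
    using True by (intro rel_sign_trans finite_A inj) (simp add: image)
  have "sum ?s (A \<rightarrow>\<^sub>E {..<n}) = of_int (grid_sign f\<^sub>0 \<alpha>) *
      (\<Sum>f\<in>A \<rightarrow>\<^sub>E {..<n}. of_int (G.grid_sign f \<alpha>) * (\<Prod>p\<in>A. g $$ (f\<^sub>0 p, f p)))"
    unfolding sum_distrib_left by (intro sum.cong refl, subst trans) (simp add: mult.assoc)
  thus ?thesis using G.sum_grid_sign_eq_det_pow[OF g] by simp
next
  case False
  hence zero: "grid_sign f\<^sub>0 \<alpha> = 0"
    by (simp add: rel_sign_def image)
  have "sum ?s (A \<rightarrow>\<^sub>E {..<n}) = 0"
  proof (cases "\<alpha> \<in> A \<rightarrow> L")
    case \<alpha>: True
    have "\<not> inj_on (\<lambda>p. (f\<^sub>0 p, \<alpha> p)) A"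
    proof
      assume inj: "inj_on (\<lambda>p. (f\<^sub>0 p, \<alpha> p)) A"
      have "(\<lambda>p. (f\<^sub>0 p, \<alpha> p)) ` A = {..<n} \<times> L"
        using f\<^sub>0 \<alpha> finite_L card_image[OF inj] card_A by (intro card_subset_eq) auto
      with False inj show False by (simp add: bij_betw_def)
    qed
    then obtain p q where pq: "p \<in> A" "q \<in> A" "p \<noteq> q" "f\<^sub>0 p = f\<^sub>0 q" "\<alpha> p = \<alpha> q"
      by (auto simp: inj_on_def)
    define \<tau> where "\<tau> = Transposition.transpose p q"
    have \<tau>: "\<tau> permutes A" "sign \<tau> = -1"
      using pq by (auto simp: \<tau>_def permutes_swap_id sign_swap_id)
    have inv: "f\<^sub>0 (\<tau> x) = f\<^sub>0 x" "\<alpha> (\<tau> x) = \<alpha> x" for x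
      using pq by (auto simp: \<tau>_def Transposition.transpose_def)
    have "?s (\<lambda>x. f (\<tau> x)) = - ?s f" for f
    proof -
      have "grid_sign (\<lambda>x. f (\<tau> x)) \<alpha> = grid_sign (\<lambda>x. f (\<tau> x)) (\<lambda>x. \<alpha> (\<tau> x))"
        by (simp add: inv)
      also have "\<dots> = - grid_sign f \<alpha>"
        using rel_sign_permute[OF finite_A inj \<tau>(1), of "\<lambda>x. (f x, \<alpha> x)"] \<tau>(2) by simp
      finally have "grid_sign (\<lambda>x. f (\<tau> x)) \<alpha> = - grid_sign f \<alpha>" .
      moreover have "(\<Prod>x\<in>A. g $$ (f\<^sub>0 x, f (\<tau> x))) = (\<Prod>x\<in>A. g $$ (f\<^sub>0 x, f x))"
        using prod.permute[OF \<tau>(1), of "\<lambda>x. g $$ (f\<^sub>0 x, f x)"] by (simp add: inv o_def)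
      ultimately show ?thesis by simp
    qed
    hence "(\<Sum>f\<in>A \<rightarrow>\<^sub>E {..<n}. ?s (\<lambda>x. f (\<tau> x))) = - sum ?s (A \<rightarrow>\<^sub>E {..<n})"
      unfolding sum_negf[symmetric] by (rule sum.cong[OF refl])
    moreover have "z = 0" if "z = - z" for z :: complex
      using that by (auto simp: complex_eq_iff)
    ultimately show ?thesis
      unfolding sum_PiE_permute[OF \<tau>(1), of ?s] by blast
  next
    case not_in: False
    have "grid_sign f \<alpha> = 0" for f
    proof -
      have "\<not> bij_betw (\<lambda>p. (f p, \<alpha> p)) A ({..<n} \<times> L)"
        using not_in by (auto simp: bij_betw_def)
      thus ?thesis by (simp add: rel_sign_def image)
    qed
    thus ?thesis by simp
  qed
  with zero show ?thesis by simp
qed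

end

section \<open>Products of signs over slices\<close>

lemma rank_in_bij:
  assumes r: "linear_order_on C r" and S: "S \<subseteq> C" "finite S"
  shows "bij_betw (rank_in r S) S {..<card S}"
proof -
  have less: "rank_in r S s < rank_in r S t" if st: "s \<in> S" "t \<in> S" "(s, t) \<in> r" "s \<noteq> t" for s t
    unfolding rank_in_def
  proof (rule psubset_card_mono)
    have "trans r" "antisym r"
      using r by (auto simp: linear_order_on_def partial_order_on_def preorder_on_def)
    hence "(x, t) \<in> r \<and> x \<noteq> t" if "(x, s) \<in> r" "x \<noteq> s" for x
      using that st(3,4) transD[of r x s t] antisymD[of r s t] by blast
    thus "{x \<in> S. (x, s) \<in> r \<and> x \<noteq> s} \<subset> {x \<in> S. (x, t) \<in> r \<and> x \<noteq> t}"
      using st by blast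
  qed (use S in auto)
  have "inj_on (rank_in r S) S"
  proof (rule inj_onI, rule ccontr)
    fix s t assume st: "s \<in> S" "t \<in> S" "rank_in r S s = rank_in r S t" "s \<noteq> t"
    hence "(s, t) \<in> r \<or> (t, s) \<in> r"
      using r S by (auto simp: linear_order_on_def total_on_def)
    thus False using less[of s t] less[of t s] st by auto
  qed
  moreover have "rank_in r S ` S \<subseteq> {..<card S}"
    unfolding rank_in_def using S(2) by (auto intro!: psubset_card_mono)
  moreover have "rank_in r S ` S = {..<card S}"
    using calculation by (intro card_subset_eq) (auto simp: card_image)
  ultimately show ?thesis by (simp add: bij_betw_def)
qed

text \<open>
  Conjugation with the order isomorphism turns \<open>\<pi>\<close> into a permutation of \<open>{..<card S}\<close> of the same sign.
\<close>

lemma bij_sign_permute: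
  assumes r: "linear_order_on C r" "S \<subseteq> C" "finite S"
    and v: "bij_betw v S {..<card S}"
    and \<pi>: "bij_betw \<pi> S S" and \<alpha>: "\<And>p. p \<in> S \<Longrightarrow> \<alpha> p = v (\<pi> p)"
  shows "bij_sign r S \<alpha> = bij_sign r S v * sign_on S \<pi>"
proof -
  define \<rho> where "\<rho> = rank_in r S"
  have \<rho>: "bij_betw \<rho> S {..<card S}" unfolding \<rho>_def using r by (rule rank_in_bij)
  define w where "w = (\<lambda>i. if i < card S then v (inv_into S \<rho> i) else i)"
  define \<kappa> where "\<kappa> = map_permutation S \<rho> (restrict_id \<pi> S)"
  have \<pi>': "restrict_id \<pi> S permutes S" using \<pi> by (rule permutes_restrict_id)
  have w_eq: "w = restrict_id (v \<circ> inv_into S \<rho>) {..<card S}"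
    by (auto simp: w_def restrict_id_def)
  have "bij_betw (v \<circ> inv_into S \<rho>) {..<card S} {..<card S}"
    using \<rho> v by (meson bij_betw_inv_into bij_betw_trans)
  hence w: "w permutes {..<card S}" unfolding w_eq by (rule permutes_restrict_id)
  have \<kappa>: "\<kappa> permutes {..<card S}"
    unfolding \<kappa>_def using \<rho> \<pi>' by (rule map_permutation_permutes)
  have "(\<lambda>i. if i < card S then \<alpha> (inv_into S \<rho> i) else i) = w \<circ> \<kappa>"
  proof
    fix i
    show "(if i < card S then \<alpha> (inv_into S \<rho> i) else i) = (w \<circ> \<kappa>) i"
    proof (cases "i < card S")
      case True
      then obtain p where p: "p \<in> S" "i = \<rho> p" using \<rho> by (auto simp: bij_betw_def)
      have inj: "inj_on \<rho> S" using \<rho> by (simp add: bij_betw_def)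
      have \<pi>p: "\<pi> p \<in> S" using \<pi> p by (auto simp: bij_betw_def)
      have "\<kappa> i = \<rho> (\<pi> p)"
        unfolding \<kappa>_def p(2) using map_permutation_apply[OF inj p(1)] p(1) by simp
      moreover have "\<rho> (\<pi> p) < card S" using \<rho> \<pi>p by (auto simp: bij_betw_def)
      ultimately show ?thesis
        using True p \<pi>p inj \<alpha> by (simp add: w_def)
    next
      case False
      thus ?thesis using permutes_not_in[OF \<kappa>, of i] by (simp add: w_def)
    qed
  qed
  hence "bij_sign r S \<alpha> = sign (w \<circ> \<kappa>)"
    unfolding bij_sign_def \<rho>_def by (simp only:)
  also have "\<dots> = sign w * sign \<kappa>"
    using w \<kappa> by (intro sign_compose) (auto intro: permutes_imp_permutation)
  also have "sign w = bij_sign r S v"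
    unfolding bij_sign_def w_def \<rho>_def by (simp only:)
  also have "sign \<kappa> = sign_on S \<pi>"
    unfolding \<kappa>_def sign_on_def using \<rho> \<pi>' r(3) by (intro sign_map_permutation) (auto simp: bij_betw_def)
  finally show ?thesis .
qed

text \<open>
  The ordering of the cube affects the signs on the slices only through the factor \<open>\<epsilon>\<close>, the slice sign
  of the reference labeling \<open>v\<close>: relative to \<open>v\<close>, a labeling that is bijective on all slices is a
  permutation preserving the slices, whose sign is the product of its signs on the slices.
\<close>

lemma slices_sgn_eq_rel_sign:
  assumes r: "linear_order_on (cube n) r"
    and grid: "grid (cube n) u v n {..<n\<^sup>2}"
    and slice: "\<And>l. l < n \<Longrightarrow> slice l = {p \<in> cube n. u p = l}"
  obtains \<epsilon> :: int where "\<epsilon> * \<epsilon> = 1"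
    "\<And>\<alpha>. slices_sgn r n slice \<alpha>
      = \<epsilon> * rel_sign (cube n) (\<lambda>p. (u p, v p)) (\<lambda>p. (u p, \<alpha> p))"
proof
  interpret grid "cube n" u v n "{..<n\<^sup>2}" by (rule grid)
  let ?\<epsilon> = "\<Prod>l<n. bij_sign r (slice l) v"
  show "?\<epsilon> * ?\<epsilon> = 1"
    by (simp add: prod.distrib[symmetric] bij_sign_def)
  fix \<alpha>
  have slice_v: "bij_betw v (slice l) {..<n\<^sup>2}" if "l < n" for l
  proof (rule bij_betw_imageI)
    show "inj_on v (slice l)" using slice[OF that] by (intro inj_onI grid_eqI) auto
    show "v ` slice l = {..<n\<^sup>2}"
    proof
      show "v ` slice l \<subseteq> {..<n\<^sup>2}" using slice[OF that] v_in by auto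
      show "{..<n\<^sup>2} \<subseteq> v ` slice l"
      proof
        fix k assume "k \<in> {..<n\<^sup>2}"
        from cell[OF that this] show "k \<in> v ` slice l"
          using slice[OF that] by (intro image_eqI[of _ _ "cell l k"]) auto
      qed
    qed
  qed
  have card_slice: "card (slice l) = n\<^sup>2" if "l < n" for l
    using bij_betw_same_card[OF slice_v[OF that]] by simp
  have iff: "(\<forall>l<n. bij_betw \<alpha> (slice l) {..<n\<^sup>2})
      \<longleftrightarrow> bij_betw (\<lambda>p. (u p, \<alpha> p)) (cube n) ({..<n} \<times> {..<n\<^sup>2})" (is "?l \<longleftrightarrow> ?r")
  proof
    assume l: ?l
    have in_slice: "p \<in> slice (u p)" "u p < n" if "p \<in> cube n" for p
      using that u_less slice by auto
    have inj: "inj_on (\<lambda>p. (u p, \<alpha> p)) (cube n)"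
    proof (rule inj_onI)
      fix p q assume pq: "p \<in> cube n" "q \<in> cube n" "(u p, \<alpha> p) = (u q, \<alpha> q)"
      have "inj_on \<alpha> (slice (u p))" using l in_slice(2)[OF pq(1)] by (simp add: bij_betw_def)
      moreover have "\<alpha> p = \<alpha> q" "u p = u q" using pq(3) by simp_all
      moreover have "q \<in> slice (u p)" using \<open>u p = u q\<close> in_slice(1)[OF pq(2)] by simp
      ultimately show "p = q" using in_slice(1)[OF pq(1)] by (intro inj_onD[of \<alpha> "slice (u p)"])
    qed
    have "(\<lambda>p. (u p, \<alpha> p)) ` cube n \<subseteq> {..<n} \<times> {..<n\<^sup>2}"
    proof (rule image_subsetI)
      fix p assume p: "p \<in> cube n"
      have "\<alpha> ` slice (u p) = {..<n\<^sup>2}" using l in_slice(2)[OF p] by (simp add: bij_betw_def)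
      thus "(u p, \<alpha> p) \<in> {..<n} \<times> {..<n\<^sup>2}" using in_slice[OF p] by auto
    qed
    hence "(\<lambda>p. (u p, \<alpha> p)) ` cube n = {..<n} \<times> {..<n\<^sup>2}"
      using card_image[OF inj] card_A by (intro card_subset_eq) auto
    with inj show ?r by (simp add: bij_betw_def)
  next
    assume R: ?r
    show ?l
    proof (intro allI impI bij_betw_imageI)
      fix l assume l: "l < n"
      show "inj_on \<alpha> (slice l)"
        using R slice[OF l] by (auto simp: bij_betw_def inj_on_def)
      have *: "(\<lambda>p. (u p, \<alpha> p)) ` cube n = {..<n} \<times> {..<n\<^sup>2}" using R by (simp add: bij_betw_def)
      have "k \<in> \<alpha> ` slice l" if "k < n\<^sup>2" for k
      proof -
        have "(l, k) \<in> (\<lambda>p. (u p, \<alpha> p)) ` cube n" using l that by (simp add: *)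
        thus ?thesis using slice[OF l] by auto
      qed
      moreover have "\<alpha> p < n\<^sup>2" if "p \<in> cube n" for p
      proof -
        have "(u p, \<alpha> p) \<in> {..<n} \<times> {..<n\<^sup>2}" unfolding *[symmetric] using that by (rule imageI)
        thus ?thesis by simp
      qed
      ultimately show "\<alpha> ` slice l = {..<n\<^sup>2}" using slice[OF l] by auto
    qed
  qed
  show "slices_sgn r n slice \<alpha> = ?\<epsilon> * grid_sign u \<alpha>"
  proof (cases ?l)
    case True
    have "bij_betw (\<lambda>p. (u p, \<alpha> p)) (cube n) ((\<lambda>p. (u p, v p)) ` cube n)"
      using True by (simp add: iff image)
    then obtain \<pi> where \<pi>: "\<pi> permutes cube n"
      and eq: "\<And>p. p \<in> cube n \<Longrightarrow> (u p, \<alpha> p) = (u (\<pi> p), v (\<pi> p))"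
      using rel_sign_nonzero_obtains[OF inj] by blast
    have "sign \<pi> = sign_on {p \<in> cube n. u p \<in> {..<n}} \<pi>"
    proof -
      have "{p \<in> cube n. u p \<in> {..<n}} = cube n" using u_less by auto
      thus ?thesis using sign_on_permutes[OF \<pi>, of "cube n"] by simp
    qed
    also have "\<dots> = (\<Prod>l<n. sign_on {p \<in> cube n. u p = l} \<pi>)"
      using eq by (intro sign_on_fibres finite_A \<pi>) auto
    also have "\<dots> = (\<Prod>l<n. sign_on (slice l) \<pi>)"
      by (intro prod.cong refl) (simp add: slice)
    finally have "?\<epsilon> * grid_sign u \<alpha> = (\<Prod>l<n. bij_sign r (slice l) v * sign_on (slice l) \<pi>)"
      using rel_sign_eq_sign[OF inj \<pi> eq] by (simp add: prod.distrib)
    also have "\<dots> = (\<Prod>l<n. bij_sign r (slice l) \<alpha>)"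
    proof (intro prod.cong refl)
      fix l assume "l \<in> {..<n}"
      hence l: "l < n" by simp
      have S: "slice l \<subseteq> cube n" "finite (slice l)"
        using slice[OF l] finite_A by auto
      have "\<pi> ` slice l \<subseteq> slice l"
        using slice[OF l] eq permutes_in_image[OF \<pi>] by auto
      hence "bij_betw \<pi> (slice l) (slice l)"
        using S permutes_inj_on[OF \<pi>] by (intro bij_betw_imageI endo_inj_surj)
      hence "bij_sign r (slice l) \<alpha> = bij_sign r (slice l) v * sign_on (slice l) \<pi>"
        using slice_v[OF l] card_slice[OF l] S eq by (intro bij_sign_permute[OF r]) auto
      thus "bij_sign r (slice l) v * sign_on (slice l) \<pi> = bij_sign r (slice l) \<alpha>" by simp
    qed
    finally show ?thesis using True by (simp add: slices_sgn_def)
  next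
    case False
    thus ?thesis by (simp add: slices_sgn_def rel_sign_def image iff)
  qed
qed

section \<open>Covariance\<close>

text \<open>
  The labels now play the part of the columns, so the grid is used with its coordinates exchanged: it
  has \<open>n\<close> rows, the slices, which gives the exponent of the determinant. The matrix is transposed because
  the summation runs over its row index.
\<close>

lemma slices_sgn_action:
  assumes r: "linear_order_on (cube n) r"
    and grid: "grid (cube n) u v n {..<n\<^sup>2}"
    and slice: "\<And>l. l < n \<Longrightarrow> slice l = {p \<in> cube n. u p = l}"
    and g: "g \<in> carrier_mat (n\<^sup>2) (n\<^sup>2)" and \<alpha>\<^sub>0: "\<alpha>\<^sub>0 \<in> labelings n"
  shows "(\<Sum>\<alpha>\<in>labelings n. of_int (slices_sgn r n slice \<alpha>) * (\<Prod>p\<in>cube n. g $$ (\<alpha> p, \<alpha>\<^sub>0 p)))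
    = det g ^ n * (of_int (slices_sgn r n slice \<alpha>\<^sub>0) :: complex)"
proof -
  interpret grid "cube n" u v n "{..<n\<^sup>2}" by (rule grid)
  obtain \<epsilon> :: int where \<epsilon>: "\<And>\<alpha>. slices_sgn r n slice \<alpha> = \<epsilon> * grid_sign u \<alpha>"
    using slices_sgn_eq_rel_sign[OF r grid slice] by blast
  have "bij_betw (prod.swap \<circ> (\<lambda>p. (u p, v p))) (cube n) ({..<n\<^sup>2} \<times> {..<n})"
    by (rule bij_betw_trans[OF bij]) (auto intro!: bij_betw_imageI simp: inj_on_def)
  then interpret T: grid "cube n" v u "n\<^sup>2" "{..<n}"
    using finite_A by unfold_locales (simp_all add: o_def)
  have swap: "T.grid_sign \<alpha> u = grid_sign u \<alpha>" for \<alpha>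
    using rel_sign_image[of prod.swap "\<lambda>p. (u p, v p)" "cube n" "\<lambda>p. (u p, \<alpha> p)"] inj by simp
  have transp: "(\<Prod>p\<in>cube n. g\<^sup>T $$ (\<alpha>\<^sub>0 p, \<alpha> p)) = (\<Prod>p\<in>cube n. g $$ (\<alpha> p, \<alpha>\<^sub>0 p))"
    if "\<alpha> \<in> labelings n" for \<alpha>
    using that \<alpha>\<^sub>0 g by (intro prod.cong refl) (auto simp: labelings_def PiE_def Pi_def)
  have "(\<Sum>\<alpha>\<in>labelings n. of_int (T.grid_sign \<alpha> u) * (\<Prod>p\<in>cube n. g\<^sup>T $$ (\<alpha>\<^sub>0 p, \<alpha> p)))
      = det g\<^sup>T ^ n * of_int (T.grid_sign \<alpha>\<^sub>0 u)"
    using T.sum_grid_sign_action[of "g\<^sup>T" \<alpha>\<^sub>0 u] g \<alpha>\<^sub>0 by (auto simp: labelings_def)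
  hence "(\<Sum>\<alpha>\<in>labelings n. of_int (grid_sign u \<alpha>) * (\<Prod>p\<in>cube n. g $$ (\<alpha> p, \<alpha>\<^sub>0 p)))
      = det g ^ n * of_int (grid_sign u \<alpha>\<^sub>0)"
    using det_transpose[OF g] by (simp add: swap transp cong: sum.cong)
  hence "of_int \<epsilon> * (\<Sum>\<alpha>\<in>labelings n. of_int (grid_sign u \<alpha>) * (\<Prod>p\<in>cube n. g $$ (\<alpha> p, \<alpha>\<^sub>0 p)))
      = of_int \<epsilon> * (det g ^ n * of_int (grid_sign u \<alpha>\<^sub>0))" by simp
  thus ?thesis by (simp add: \<epsilon> sum_distrib_left mult_ac)
qed

abbreviation x_coord :: "nat \<times> nat \<times> nat \<Rightarrow> nat" where "x_coord p \<equiv> fst p"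
abbreviation y_coord :: "nat \<times> nat \<times> nat \<Rightarrow> nat" where "y_coord p \<equiv> fst (snd p)"
abbreviation z_coord :: "nat \<times> nat \<times> nat \<Rightarrow> nat" where "z_coord p \<equiv> snd (snd p)"

lemma pair_code_less: "i < n \<Longrightarrow> j < n \<Longrightarrow> n * i + j < n\<^sup>2" for n :: nat
proof -
  assume "i < n" "j < n"
  hence "n * i + j < n * Suc i" by simp
  also have "\<dots> \<le> n * n" using \<open>i < n\<close> by (intro mult_le_mono2) simp
  finally show ?thesis by (simp add: power2_eq_square)
qed

lemma pair_decode: "a < n\<^sup>2 \<Longrightarrow> a div n < n \<and> a mod n < n" for n :: nat
  by (cases "n = 0") (auto simp: power2_eq_square less_mult_imp_div_less)

lemma grid_x: "grid (cube n) x_coord (\<lambda>p. n * y_coord p + z_coord p) n {..<n\<^sup>2}"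
  by unfold_locales
    (auto simp: cube_def pair_code_less pair_decode
      intro!: bij_betw_byWitness[where f' = "\<lambda>(i, a). (i, a div n, a mod n)"])

lemma grid_y: "grid (cube n) y_coord (\<lambda>p. n * x_coord p + z_coord p) n {..<n\<^sup>2}"
  by unfold_locales
    (auto simp: cube_def pair_code_less pair_decode
      intro!: bij_betw_byWitness[where f' = "\<lambda>(j, a). (a div n, j, a mod n)"])

lemma grid_z: "grid (cube n) z_coord (\<lambda>p. n * x_coord p + y_coord p) n {..<n\<^sup>2}"
  by unfold_locales
    (auto simp: cube_def pair_code_less pair_decode
      intro!: bij_betw_byWitness[where f' = "\<lambda>(k, a). (a div n, a mod n, k)"])

lemma slices_eq:
  "x_slice n l = {p \<in> cube n. x_coord p = l}"
  "y_slice n l = {p \<in> cube n. y_coord p = l}"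
  "z_slice n l = {p \<in> cube n. z_coord p = l}"
  by (auto simp: x_slice_def y_slice_def z_slice_def)

lemma sum_triples: "(\<Sum>t\<in>S \<times> S \<times> S. h t) = (\<Sum>a\<in>S. \<Sum>b\<in>S. \<Sum>c\<in>S. h (a, b, c))"
  by (simp add: sum.cartesian_product split_def)

lemma sum3_exchange:
  fixes x y z :: "'a \<Rightarrow> complex"
  shows "(\<Sum>a\<in>S. \<Sum>b\<in>S. \<Sum>c\<in>S. x a * y b * z c *
      (\<Sum>a'\<in>S. \<Sum>b'\<in>S. \<Sum>c'\<in>S. P a a' * Q b b' * R c c' * W a' b' c'))
    = (\<Sum>a'\<in>S. \<Sum>b'\<in>S. \<Sum>c'\<in>S. (\<Sum>a\<in>S. x a * P a a') * (\<Sum>b\<in>S. y b * Q b b')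
        * (\<Sum>c\<in>S. z c * R c c') * W a' b' c')"
proof -
  let ?h = "\<lambda>(a, b, c) (a', b', c'). x a * y b * z c * (P a a' * Q b b' * R c c' * W a' b' c')"
  have "(\<Sum>a\<in>S. \<Sum>b\<in>S. \<Sum>c\<in>S. x a * y b * z c *
      (\<Sum>a'\<in>S. \<Sum>b'\<in>S. \<Sum>c'\<in>S. P a a' * Q b b' * R c c' * W a' b' c'))
      = (\<Sum>t\<in>S \<times> S \<times> S. \<Sum>t'\<in>S \<times> S \<times> S. ?h t t')"
    by (simp add: sum_triples sum_distrib_left)
  also have "\<dots> = (\<Sum>t'\<in>S \<times> S \<times> S. \<Sum>t\<in>S \<times> S \<times> S. ?h t t')"
    by (rule sum.swap)
  also have "\<dots> = (\<Sum>a'\<in>S. \<Sum>b'\<in>S. \<Sum>c'\<in>S. \<Sum>a\<in>S. \<Sum>b\<in>S. \<Sum>c\<in>S. ?h (a, b, c) (a', b', c'))"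
    by (simp add: sum_triples)
  also have "\<dots> = (\<Sum>a'\<in>S. \<Sum>b'\<in>S. \<Sum>c'\<in>S. (\<Sum>a\<in>S. x a * P a a') * (\<Sum>b\<in>S. y b * Q b b')
        * (\<Sum>c\<in>S. z c * R c c') * W a' b' c')"
    unfolding mult.assoc sum_distrib_right unfolding sum_distrib_left
    by (intro sum.cong refl) (simp add: mult_ac)
  finally show ?thesis .
qed

lemma F_tensor_act:
  assumes r: "linear_order_on (cube n) r"
    and g: "g1 \<in> carrier_mat (n\<^sup>2) (n\<^sup>2)" "g2 \<in> carrier_mat (n\<^sup>2) (n\<^sup>2)" "g3 \<in> carrier_mat (n\<^sup>2) (n\<^sup>2)"
  shows "F r n (tensor_act (n\<^sup>2) g1 g2 g3 w) = (det g1 * det g2 * det g3) ^ n * F r n w"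
proof -
  let ?L = "labelings n" and ?C = "cube n"
  let ?P = "\<lambda>g \<alpha> \<alpha>'. \<Prod>p\<in>?C. (g :: complex mat) $$ (\<alpha> p, \<alpha>' p)"
  let ?W = "\<lambda>\<alpha> \<beta> \<gamma>. \<Prod>p\<in>?C. w (\<alpha> p) (\<beta> p) (\<gamma> p)"
  have fin: "finite ?C" by (simp add: cube_def)
  have expand: "(\<Prod>p\<in>?C. tensor_act (n\<^sup>2) g1 g2 g3 w (\<alpha> p) (\<beta> p) (\<gamma> p))
      = (\<Sum>\<alpha>'\<in>?L. \<Sum>\<beta>'\<in>?L. \<Sum>\<gamma>'\<in>?L. ?P g1 \<alpha> \<alpha>' * ?P g2 \<beta> \<beta>' * ?P g3 \<gamma> \<gamma>' * ?W \<alpha>' \<beta>' \<gamma>')"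
    if "\<alpha> \<in> ?L" "\<beta> \<in> ?L" "\<gamma> \<in> ?L" for \<alpha> \<beta> \<gamma>
  proof -
    have "(\<Prod>p\<in>?C. tensor_act (n\<^sup>2) g1 g2 g3 w (\<alpha> p) (\<beta> p) (\<gamma> p))
      = (\<Prod>p\<in>?C. \<Sum>a'<n\<^sup>2. \<Sum>b'<n\<^sup>2. \<Sum>c'<n\<^sup>2.
          g1 $$ (\<alpha> p, a') * g2 $$ (\<beta> p, b') * g3 $$ (\<gamma> p, c') * w a' b' c')"
      using that by (intro prod.cong refl) (auto simp: tensor_act_def labelings_def PiE_def Pi_def)
    also have "\<dots> = (\<Sum>\<alpha>'\<in>?L. \<Sum>\<beta>'\<in>?L. \<Sum>\<gamma>'\<in>?L. \<Prod>p\<in>?C.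
          g1 $$ (\<alpha> p, \<alpha>' p) * g2 $$ (\<beta> p, \<beta>' p) * g3 $$ (\<gamma> p, \<gamma>' p) * w (\<alpha>' p) (\<beta>' p) (\<gamma>' p))"
      using fin by (simp add: labelings_def prod_sum_PiE)
    finally show ?thesis by (simp add: prod.distrib)
  qed
  note act = slices_sgn_action[OF r grid_x slices_eq(1) g(1), folded sgn_x_def]
    slices_sgn_action[OF r grid_y slices_eq(2) g(2), folded sgn_y_def]
    slices_sgn_action[OF r grid_z slices_eq(3) g(3), folded sgn_z_def]
  have "F r n (tensor_act (n\<^sup>2) g1 g2 g3 w)
      = (\<Sum>\<alpha>\<in>?L. \<Sum>\<beta>\<in>?L. \<Sum>\<gamma>\<in>?L. of_int (sgn_x r n \<alpha>) * of_int (sgn_y r n \<beta>) * of_int (sgn_z r n \<gamma>) *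
        (\<Sum>\<alpha>'\<in>?L. \<Sum>\<beta>'\<in>?L. \<Sum>\<gamma>'\<in>?L. ?P g1 \<alpha> \<alpha>' * ?P g2 \<beta> \<beta>' * ?P g3 \<gamma> \<gamma>' * ?W \<alpha>' \<beta>' \<gamma>'))"
    unfolding F_def by (intro sum.cong refl) (simp add: expand)
  also have "\<dots> = (\<Sum>\<alpha>'\<in>?L. \<Sum>\<beta>'\<in>?L. \<Sum>\<gamma>'\<in>?L.
        (\<Sum>\<alpha>\<in>?L. of_int (sgn_x r n \<alpha>) * ?P g1 \<alpha> \<alpha>') * (\<Sum>\<beta>\<in>?L. of_int (sgn_y r n \<beta>) * ?P g2 \<beta> \<beta>')
        * (\<Sum>\<gamma>\<in>?L. of_int (sgn_z r n \<gamma>) * ?P g3 \<gamma> \<gamma>') * ?W \<alpha>' \<beta>' \<gamma>')"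
    by (rule sum3_exchange)
  also have "\<dots> = (\<Sum>\<alpha>'\<in>?L. \<Sum>\<beta>'\<in>?L. \<Sum>\<gamma>'\<in>?L. (det g1 * det g2 * det g3) ^ n *
        (of_int (sgn_x r n \<alpha>') * of_int (sgn_y r n \<beta>') * of_int (sgn_z r n \<gamma>') * ?W \<alpha>' \<beta>' \<gamma>'))"
    by (intro sum.cong refl) (simp add: act power_mult_distrib mult_ac)
  finally show ?thesis by (simp add: F_def sum_distrib_left)
qed

section \<open>Coefficients of a vanishing polynomial function\<close>

text \<open>
  A polynomial function in the variables \<open>g s\<close>, \<open>s \<in> S\<close>, that vanishes identically has zero
  coefficients, where terms with equal exponents have to be collected. The variables are treated one at a
  time, each by the univariate case.
\<close>

lemma vanishing_exponent_classes:
  fixes c :: "'t \<Rightarrow> complex" and e :: "'t \<Rightarrow> 's \<Rightarrow> nat"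
  assumes "finite S" "finite T"
    and "\<And>g. (\<Sum>t\<in>T. c t * (\<Prod>s\<in>S. g s ^ e t s)) = 0"
  shows "(\<Sum>t | t \<in> T \<and> (\<forall>s\<in>S. e t s = d s). c t) = 0"
  using assms
proof (induction S arbitrary: T rule: finite_induct)
  case empty
  from empty.prems(2) show ?case by simp
next
  case (insert s S)
  define T' where "T' = {t \<in> T. e t s = d s}"
  have "(\<Sum>t\<in>T'. c t * (\<Prod>s\<in>S. g s ^ e t s)) = 0" for g
  proof -
    define q where "q = (\<Sum>t\<in>T. monom (c t * (\<Prod>s\<in>S. g s ^ e t s)) (e t s))"
    have "poly q x = 0" for x
    proof -
      have "(\<Prod>s'\<in>S. (g(s := x)) s' ^ e t s') = (\<Prod>s'\<in>S. g s' ^ e t s')" for t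
        using insert.hyps by (intro prod.cong) auto
      hence "poly q x = (\<Sum>t\<in>T. c t * (\<Prod>s'\<in>insert s S. (g(s := x)) s' ^ e t s'))"
        using insert.hyps by (simp add: q_def poly_sum poly_monom mult_ac)
      thus ?thesis using insert.prems(2) by simp
    qed
    hence "coeff q (d s) = 0" using poly_all_0_iff_0[of q] by simp
    thus ?thesis
      using insert.prems(1) by (simp add: q_def coeff_sum T'_def sum.inter_filter)
  qed
  hence "(\<Sum>t | t \<in> T' \<and> (\<forall>s\<in>S. e t s = d s). c t) = 0"
    using insert.prems(1) by (intro insert.IH) (simp_all add: T'_def)
  moreover have "{t. t \<in> T' \<and> (\<forall>s\<in>S. e t s = d s)} = {t. t \<in> T \<and> (\<forall>s\<in>insert s S. e t s = d s)}"
    by (auto simp: T'_def)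
  ultimately show ?case by simp
qed

text \<open>
  Two monomials \<open>\<Prod>p\<in>A. g (key t p)\<close> are equal precisely if their keys differ by a permutation of \<open>A\<close>. So a
  weight that is invariant under such permutations is constant on the classes of equal monomials, whose
  coefficient sums are zero.
\<close>

lemma vanishing_symmetric_weight:
  fixes c w :: "'t \<Rightarrow> complex" and key :: "'t \<Rightarrow> 'a \<Rightarrow> 's"
  assumes fin: "finite T" "finite A"
    and vanish: "\<And>g. (\<Sum>t\<in>T. c t * (\<Prod>p\<in>A. g (key t p))) = 0"
    and weight: "\<And>t t' \<sigma>. t \<in> T \<Longrightarrow> t' \<in> T \<Longrightarrow> \<sigma> permutes A \<Longrightarrow>
      (\<And>p. p \<in> A \<Longrightarrow> key t p = key t' (\<sigma> p)) \<Longrightarrow> w t = w t'"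
  shows "(\<Sum>t\<in>T. c t * w t) = 0"
proof -
  define m where "m = (\<lambda>t. image_mset (key t) (mset_set A))"
  define S where "S = (\<Union>t\<in>T. key t ` A)"
  have finS: "finite S" using fin by (simp add: S_def)
  have mS: "set_mset (m t) \<subseteq> S" if "t \<in> T" for t
    using that fin by (auto simp: m_def S_def)
  have monomial: "(\<Prod>p\<in>A. g (key t p)) = (\<Prod>s\<in>S. g s ^ count (m t) s)" if "t \<in> T" for g :: "'s \<Rightarrow> complex" and t
  proof -
    have "(\<Prod>p\<in>A. g (key t p)) = prod_mset (image_mset g (m t))"
      by (simp add: m_def prod_unfold_prod_mset image_mset.compositionality o_def)
    also have "\<dots> = (\<Prod>s\<in>set_mset (m t). g s ^ count (m t) s)"
      by (rule image_prod_mset_multiplicity)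
    also have "\<dots> = (\<Prod>s\<in>S. g s ^ count (m t) s)"
      using finS mS[OF that] by (intro prod.mono_neutral_left) (auto simp: not_in_iff)
    finally show ?thesis .
  qed
  have "(\<Sum>t | t \<in> T \<and> m t = m t\<^sub>0. c t * w t) = 0" if t\<^sub>0: "t\<^sub>0 \<in> T" for t\<^sub>0
  proof -
    have "(\<Sum>t | t \<in> T \<and> (\<forall>s\<in>S. count (m t) s = count (m t\<^sub>0) s). c t) = 0"
    proof (rule vanishing_exponent_classes[OF finS fin(1)])
      fix g :: "'s \<Rightarrow> complex"
      show "(\<Sum>t\<in>T. c t * (\<Prod>s\<in>S. g s ^ count (m t) s)) = 0"
        using vanish[of g] by (simp add: monomial cong: sum.cong)
    qed
    moreover have "(\<forall>s\<in>S. count (m t) s = count (m t\<^sub>0) s) \<longleftrightarrow> m t = m t\<^sub>0" if "t \<in> T" for t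
      using mS[OF that] mS[OF t\<^sub>0] by (metis multiset_eqI not_in_iff subsetD)
    ultimately have "(\<Sum>t | t \<in> T \<and> m t = m t\<^sub>0. c t) = 0"
      by (simp cong: conj_cong)
    moreover have "w t = w t\<^sub>0" if t: "t \<in> T" and mt: "m t = m t\<^sub>0" for t
    proof -
      obtain \<sigma> where "\<sigma> permutes A" "\<forall>p\<in>A. key t p = key t\<^sub>0 (\<sigma> p)"
        using image_mset_eq_implies_permutes[OF fin(2)] mt unfolding m_def by metis
      thus ?thesis using weight[OF t t\<^sub>0] by blast
    qed
    hence "(\<Sum>t | t \<in> T \<and> m t = m t\<^sub>0. c t * w t) = (\<Sum>t | t \<in> T \<and> m t = m t\<^sub>0. c t) * w t\<^sub>0"
      unfolding sum_distrib_right by (intro sum.cong refl) simp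
    ultimately show ?thesis by simp
  qed
  moreover have "(\<Sum>t\<in>T. c t * w t) = (\<Sum>M\<in>m ` T. \<Sum>t | t \<in> T \<and> m t = M. c t * w t)"
    by (rule sum.image_gen[OF fin(1)])
  ultimately show ?thesis by (simp add: sum.neutral)
qed

text \<open>
  The coefficient of the monomial with key \<open>h\<close> as a sum over all permutations, where each \<open>t\<close> is counted
  once for every \<open>\<pi>\<close> such that \<open>t\<close> has key \<open>h \<circ> \<pi>\<close>. This number is a weight of the above kind, because it
  is the order of the stabilizer of \<open>h\<close> for all \<open>t\<close> that contribute to this monomial.
\<close>

lemma vanishing_permuted_key:
  fixes c :: "'t \<Rightarrow> complex" and key :: "'t \<Rightarrow> 'a \<Rightarrow> 's"
  assumes fin: "finite T" "finite A"
    and vanish: "\<And>g. (\<Sum>t\<in>T. c t * (\<Prod>p\<in>A. g (key t p))) = 0"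
  shows "(\<Sum>\<pi> | \<pi> permutes A. \<Sum>t\<in>T. if \<forall>p\<in>A. key t p = h (\<pi> p) then c t else 0) = 0"
proof -
  let ?w = "\<lambda>t. \<Sum>\<pi> | \<pi> permutes A. if \<forall>p\<in>A. key t p = h (\<pi> p) then 1 else (0 :: complex)"
  have "(\<Sum>t\<in>T. c t * ?w t) = 0"
  proof (rule vanishing_symmetric_weight[OF fin vanish])
    fix t t' \<tau> assume \<tau>: "\<tau> permutes A" and eq: "\<And>p. p \<in> A \<Longrightarrow> key t p = key t' (\<tau> p)"
    have "(\<forall>p\<in>A. key t p = h (\<pi> (\<tau> p))) \<longleftrightarrow> (\<forall>q\<in>A. key t' q = h (\<pi> q))" for \<pi>
    proof -
      have "(\<forall>p\<in>A. key t p = h (\<pi> (\<tau> p))) \<longleftrightarrow> (\<forall>p\<in>A. key t' (\<tau> p) = h (\<pi> (\<tau> p)))"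
        using eq by simp
      also have "\<dots> \<longleftrightarrow> (\<forall>q\<in>\<tau> ` A. key t' q = h (\<pi> q))" by simp
      finally show ?thesis by (simp only: permutes_image[OF \<tau>])
    qed
    thus "?w t = ?w t'"
      by (subst sum_permutations_compose_right[OF \<tau>]) (simp only: o_def)
  qed
  also have "(\<Sum>t\<in>T. c t * ?w t)
      = (\<Sum>t\<in>T. \<Sum>\<pi> | \<pi> permutes A. if \<forall>p\<in>A. key t p = h (\<pi> p) then c t else 0)"
    unfolding sum_distrib_left by (intro sum.cong refl) simp
  finally show ?thesis by (subst sum.swap)
qed

section \<open>Invariants orthogonal to all products of row determinants\<close>

context grid
begin

text \<open>
  The pairs of nonzero sign are those of the form \<open>(u \<circ> \<pi>, v \<circ> \<pi>)\<close>.
\<close>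

lemma sum_grid_sign_pairs:
  assumes "\<And>f f' \<alpha> \<alpha>'. (\<And>p. p \<in> A \<Longrightarrow> f p = f' p) \<Longrightarrow> (\<And>p. p \<in> A \<Longrightarrow> \<alpha> p = \<alpha>' p) \<Longrightarrow> G f \<alpha> = G f' \<alpha>'"
  shows "(\<Sum>f\<in>A \<rightarrow>\<^sub>E {..<n}. \<Sum>\<alpha>\<in>A \<rightarrow>\<^sub>E L. grid_sign f \<alpha> * G f \<alpha>)
    = (\<Sum>\<pi> | \<pi> permutes A. sign \<pi> * (G (\<lambda>p. u (\<pi> p)) (\<lambda>p. v (\<pi> p)) :: int))"
proof -
  let ?T = "(A \<rightarrow>\<^sub>E {..<n}) \<times> (A \<rightarrow>\<^sub>E L)"
  let ?h = "\<lambda>\<pi>. (restrict (\<lambda>p. u (\<pi> p)) A, restrict (\<lambda>p. v (\<pi> p)) A)"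
  let ?s = "\<lambda>(f, \<alpha>). grid_sign f \<alpha> * G f \<alpha>"
  let ?P = "{\<pi>. \<pi> permutes A}"
  have "(\<Sum>f\<in>A \<rightarrow>\<^sub>E {..<n}. \<Sum>\<alpha>\<in>A \<rightarrow>\<^sub>E L. grid_sign f \<alpha> * G f \<alpha>) = sum ?s ?T"
    by (simp add: sum.cartesian_product)
  also have "\<dots> = sum ?s (?h ` ?P)"
  proof (rule sum.mono_neutral_right)
    show "finite ?T" using finite_A finite_L by (intro finite_cartesian_product finite_PiE) auto
    show "?h ` ?P \<subseteq> ?T"
      using u_less v_in by (auto simp: permutes_in_image)
    show "\<forall>t\<in>?T - ?h ` ?P. ?s t = 0"
    proof (rule ballI, rule ccontr)
      fix t assume t: "t \<in> ?T - ?h ` ?P" and nz: "?s t \<noteq> 0"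
      obtain f \<alpha> where [simp]: "t = (f, \<alpha>)" by (cases t)
      have "bij_betw (\<lambda>p. (f p, \<alpha> p)) A ((\<lambda>p. (u p, v p)) ` A)"
        using nz by (auto simp: rel_sign_def split: if_splits)
      then obtain \<pi> where \<pi>: "\<pi> permutes A" "\<And>p. p \<in> A \<Longrightarrow> (f p, \<alpha> p) = (u (\<pi> p), v (\<pi> p))"
        using rel_sign_nonzero_obtains[OF inj] by blast
      have "f = fst (?h \<pi>)" "\<alpha> = snd (?h \<pi>)"
        using t \<pi>(2) by (auto simp: fun_eq_iff restrict_def PiE_def extensional_def)
      hence "t = ?h \<pi>" by simp
      with t \<pi>(1) show False by blast
    qed
  qed
  also have "\<dots> = (\<Sum>\<pi>\<in>?P. ?s (?h \<pi>))"
  proof (rule sum.reindex[unfolded o_def], rule inj_onI)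
    fix \<pi> \<kappa> assume *: "\<pi> \<in> ?P" "\<kappa> \<in> ?P" and eq: "?h \<pi> = ?h \<kappa>"
    show "\<pi> = \<kappa>"
    proof
      fix p
      show "\<pi> p = \<kappa> p"
      proof (cases "p \<in> A")
        case True
        have "u (\<pi> p) = u (\<kappa> p)" "v (\<pi> p) = v (\<kappa> p)"
          using eq True by (auto simp: fun_eq_iff restrict_def split: if_splits)
        thus ?thesis using * True by (intro grid_eqI) (auto simp: permutes_in_image)
      next
        case False
        thus ?thesis using * by (auto simp: permutes_not_in)
      qed
    qed
  qed
  also have "\<dots> = (\<Sum>\<pi>\<in>?P. sign \<pi> * G (\<lambda>p. u (\<pi> p)) (\<lambda>p. v (\<pi> p)))"
  proof (intro sum.cong refl)
    fix \<pi> assume "\<pi> \<in> ?P"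
    hence "grid_sign (fst (?h \<pi>)) (snd (?h \<pi>)) = sign \<pi>"
      by (intro rel_sign_eq_sign inj) auto
    moreover have "G (fst (?h \<pi>)) (snd (?h \<pi>)) = G (\<lambda>p. u (\<pi> p)) (\<lambda>p. v (\<pi> p))"
      by (intro assms) auto
    ultimately show "?s (?h \<pi>) = sign \<pi> * G (\<lambda>p. u (\<pi> p)) (\<lambda>p. v (\<pi> p))" by simp
  qed
  finally show ?thesis .
qed

text \<open>
  Let \<open>I f = (\<Sum>\<alpha>. grid_sign f \<alpha> * C \<alpha>)\<close> and \<open>D f = grid_sign f v\<close>. Both are invariants: under a
  substitution by \<open>g\<close> they are multiplied by \<open>det g ^ card L\<close>. The hypothesis says that \<open>I\<close> is orthogonal
  to all translates of \<open>D\<close> by permutations of \<open>A\<close>, and the conclusion that \<open>I u = 0\<close>.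

  Since \<open>D u = 1\<close>, the invariant \<open>J = I - I u \<cdot> D\<close> vanishes at \<open>u\<close>, so
  \<open>(\<Sum>f. J f \<cdot> (\<Prod>p. g (u p, f p))) = 0\<close> for all \<open>g\<close>. The sum \<open>w\<close> of the translates of \<open>D\<close> under the
  stabilizer of \<open>u\<close> depends only on the monomial of \<open>f\<close>, hence \<open>J\<close> is orthogonal to \<open>w\<close>. As \<open>I\<close> is
  orthogonal to \<open>w\<close> too, \<open>I u \<cdot> \<langle>D, w\<rangle> = 0\<close>. Finally \<open>\<langle>D, w\<rangle>\<close> is \<open>\<langle>w, w\<rangle>\<close> divided by the order of the
  stabilizer, which is positive. This positivity replaces the evaluation of the constant in Cayley's
  Omega process.
\<close>

lemma stabilizer_sum_eq_0:
  fixes C :: "('a \<Rightarrow> 'l) \<Rightarrow> int"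
  assumes C_cong: "\<And>\<alpha> \<alpha>'. (\<And>p. p \<in> A \<Longrightarrow> \<alpha> p = \<alpha>' p) \<Longrightarrow> C \<alpha> = C \<alpha>'"
    and orth: "\<And>\<rho>. \<rho> permutes A \<Longrightarrow>
      (\<Sum>\<pi> | \<pi> permutes A. sign \<pi> * (C (\<lambda>p. v (\<pi> p)) * grid_sign (\<lambda>p. u (\<pi> (\<rho> p))) v)) = 0"
  shows "(\<Sum>\<pi> | \<pi> permutes A. sign \<pi> * (if \<forall>p\<in>A. u (\<pi> p) = u p then C (\<lambda>p. v (\<pi> p)) else 0)) = 0"
proof -
  define I where "I = (\<lambda>f. \<Sum>\<alpha>\<in>A \<rightarrow>\<^sub>E L. grid_sign f \<alpha> * C \<alpha>)"
  define D where "D = (\<lambda>f. grid_sign f v)"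
  define R where "R = {\<rho>. \<rho> permutes A \<and> (\<forall>p\<in>A. u (\<rho> p) = u p)}"
  define w where "w = (\<lambda>f. \<Sum>\<rho>\<in>R. D (\<lambda>p. f (\<rho> p)))"
  let ?U = "A \<rightarrow>\<^sub>E {..<n}"
  have finU: "finite ?U" using finite_A by (intro finite_PiE) auto
  have finR: "finite R" unfolding R_def by (rule finite_subset[OF _ finite_permutations[OF finite_A]]) auto
  have R_perm: "\<rho> permutes A" if "\<rho> \<in> R" for \<rho> using that by (simp add: R_def)
  have D_cong: "D f = D f'" if "\<And>p. p \<in> A \<Longrightarrow> f p = f' p" for f f'
    unfolding D_def using that by (intro rel_sign_cong) simp

  have w_invariant: "w (\<lambda>p. f (\<sigma> p)) = w f" if \<sigma>: "\<sigma> \<in> R" for \<sigma> f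
  proof -
    have inv: "inv_into UNIV \<sigma> \<in> R"
    proof -
      have "inv_into UNIV \<sigma> permutes A" using R_perm[OF \<sigma>] by (rule permutes_inv)
      moreover have "u (inv_into UNIV \<sigma> p) = u p" if "p \<in> A" for p
      proof -
        have "inv_into UNIV \<sigma> p \<in> A" using calculation that by (simp add: permutes_in_image)
        hence "u (\<sigma> (inv_into UNIV \<sigma> p)) = u (inv_into UNIV \<sigma> p)" using \<sigma> by (simp add: R_def)
        thus ?thesis by (simp add: permutes_inverses[OF R_perm[OF \<sigma>]])
      qed
      ultimately show ?thesis by (simp add: R_def)
    qed
    have comp: "\<kappa> \<circ> \<rho> \<in> R" if "\<kappa> \<in> R" "\<rho> \<in> R" for \<kappa> \<rho>
      using that by (auto simp: R_def permutes_compose permutes_in_image)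
    have "(\<Sum>\<rho>\<in>R. D (\<lambda>p. f ((\<sigma> \<circ> \<rho>) p))) = (\<Sum>\<rho>\<in>R. D (\<lambda>p. f (\<rho> p)))"
    proof (rule sum.reindex_bij_witness[where i = "\<lambda>\<rho>. inv_into UNIV \<sigma> \<circ> \<rho>" and j = "\<lambda>\<rho>. \<sigma> \<circ> \<rho>"])
      fix \<rho> assume \<rho>: "\<rho> \<in> R"
      show "inv_into UNIV \<sigma> \<circ> (\<sigma> \<circ> \<rho>) = \<rho>" "\<sigma> \<circ> (inv_into UNIV \<sigma> \<circ> \<rho>) = \<rho>"
        by (simp_all add: fun_eq_iff permutes_inverses[OF R_perm[OF \<sigma>]])
      show "\<sigma> \<circ> \<rho> \<in> R" "inv_into UNIV \<sigma> \<circ> \<rho> \<in> R" using comp \<sigma> inv \<rho> by blast+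
    qed simp
    thus ?thesis by (simp add: w_def)
  qed

  have action: "(\<Sum>f\<in>?U. of_int (I f - I u * D f) * (\<Prod>p\<in>A. g (u p, f p))) = 0"
    for g :: "nat \<times> nat \<Rightarrow> complex"
  proof -
    let ?m = "\<lambda>f. \<Prod>p\<in>A. mat n n g $$ (u p, f p)"
    have m: "(\<Prod>p\<in>A. g (u p, f p)) = ?m f" if "f \<in> ?U" for f
      using that u_less by (intro prod.cong refl) (auto simp: PiE_def Pi_def)
    have sum_\<alpha>: "(\<Sum>f\<in>?U. of_int (grid_sign f \<alpha>) * ?m f) = det (mat n n g) ^ card L * of_int (grid_sign u \<alpha>)" for \<alpha>
      using u_less by (intro sum_grid_sign_action) auto
    have "(\<Sum>f\<in>?U. of_int (I f) * ?m f)
        = (\<Sum>f\<in>?U. \<Sum>\<alpha>\<in>A \<rightarrow>\<^sub>E L. of_int (C \<alpha>) * (of_int (grid_sign f \<alpha>) * ?m f))"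
      unfolding I_def of_int_sum sum_distrib_right by (simp add: mult_ac)
    also have "\<dots> = (\<Sum>\<alpha>\<in>A \<rightarrow>\<^sub>E L. of_int (C \<alpha>) * (\<Sum>f\<in>?U. of_int (grid_sign f \<alpha>) * ?m f))"
      by (subst sum.swap) (simp add: sum_distrib_left)
    also have "\<dots> = det (mat n n g) ^ card L * of_int (I u)"
      by (simp only: sum_\<alpha>) (simp add: I_def sum_distrib_left mult_ac)
    finally have "(\<Sum>f\<in>?U. of_int (I f) * ?m f) = det (mat n n g) ^ card L * of_int (I u)" .
    moreover have "(\<Sum>f\<in>?U. of_int (D f) * ?m f) = det (mat n n g) ^ card L"
      unfolding D_def sum_\<alpha> by (simp add: rel_sign_refl[OF inj])
    hence "of_int (I u) * (\<Sum>f\<in>?U. of_int (D f) * ?m f) = of_int (I u) * det (mat n n g) ^ card L"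
      by simp
    ultimately have "(\<Sum>f\<in>?U. of_int (I f - I u * D f) * ?m f) = 0"
      by (simp add: left_diff_distrib sum_subtractf sum_distrib_left mult_ac)
    thus ?thesis by (simp add: m cong: sum.cong)
  qed

  have "(\<Sum>f\<in>?U. complex_of_int (I f - I u * D f) * of_int (w f)) = 0"
  proof (rule vanishing_symmetric_weight[OF finU finite_A, where key = "\<lambda>f p. (u p, f p)"])
    show "(\<Sum>f\<in>?U. complex_of_int (I f - I u * D f) * (\<Prod>p\<in>A. g (u p, f p))) = 0" for g
      by (rule action)
    fix f f' :: "'a \<Rightarrow> nat" and \<sigma> assume \<sigma>: "\<sigma> permutes A" and eq: "\<And>p. p \<in> A \<Longrightarrow> (u p, f p) = (u (\<sigma> p), f' (\<sigma> p))"
    have "\<sigma> \<in> R" using \<sigma> eq by (auto simp: R_def)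
    hence "w f' = w (\<lambda>p. f' (\<sigma> p))" by (simp add: w_invariant)
    also have "\<dots> = w f"
      unfolding w_def using eq R_perm by (intro sum.cong D_cong) (auto simp: permutes_in_image)
    finally show "complex_of_int (w f) = of_int (w f')" by simp
  qed
  hence "complex_of_int (\<Sum>f\<in>?U. (I f - I u * D f) * w f) = 0"
    by simp
  hence "(\<Sum>f\<in>?U. (I f - I u * D f) * w f) = 0"
    unfolding of_int_eq_0_iff .
  hence balance: "I u * (\<Sum>f\<in>?U. D f * w f) = (\<Sum>f\<in>?U. I f * w f)"
    unfolding left_diff_distrib sum_subtractf mult.assoc sum_distrib_left[symmetric] by simp
  have "(\<Sum>f\<in>?U. I f * D (\<lambda>p. f (\<rho> p))) = 0" if "\<rho> \<in> R" for \<rho>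
  proof -
    have "(\<Sum>f\<in>?U. I f * D (\<lambda>p. f (\<rho> p)))
        = (\<Sum>f\<in>?U. \<Sum>\<alpha>\<in>A \<rightarrow>\<^sub>E L. grid_sign f \<alpha> * (C \<alpha> * D (\<lambda>p. f (\<rho> p))))"
      unfolding I_def sum_distrib_right by (simp add: mult_ac)
    also have "\<dots> = (\<Sum>\<pi> | \<pi> permutes A. sign \<pi> * (C (\<lambda>p. v (\<pi> p)) * D (\<lambda>p. u (\<pi> (\<rho> p)))))"
      using R_perm[OF that]
      by (intro sum_grid_sign_pairs arg_cong2[where f = "(*)"] C_cong D_cong) (auto simp: permutes_in_image)
    also have "\<dots> = 0"
      unfolding D_def by (rule orth[OF R_perm[OF that]])
    finally show ?thesis .
  qed
  hence "(\<Sum>\<rho>\<in>R. \<Sum>f\<in>?U. I f * D (\<lambda>p. f (\<rho> p))) = 0" by simp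
  hence "(\<Sum>f\<in>?U. I f * w f) = 0"
    by (subst (asm) sum.swap) (simp add: w_def sum_distrib_left)
  with balance have "I u * (\<Sum>f\<in>?U. D f * w f) = 0" by simp
  moreover have "(\<Sum>f\<in>?U. D f * w f) \<noteq> 0"
  proof
    assume zero: "(\<Sum>f\<in>?U. D f * w f) = 0"
    have "(\<Sum>f\<in>?U. D (\<lambda>p. f (\<rho> p)) * w f) = 0" if "\<rho> \<in> R" for \<rho>
    proof -
      have "(\<Sum>f\<in>?U. D (\<lambda>p. f (\<rho> p)) * w f) = (\<Sum>f\<in>?U. D (\<lambda>p. f (\<rho> p)) * w (\<lambda>p. f (\<rho> p)))"
        using that by (simp add: w_invariant)
      also have "\<dots> = (\<Sum>f\<in>?U. D f * w f)"
        by (rule sum_PiE_permute[OF R_perm[OF that]])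
      finally show ?thesis using zero by simp
    qed
    hence "(\<Sum>\<rho>\<in>R. \<Sum>f\<in>?U. D (\<lambda>p. f (\<rho> p)) * w f) = 0" by simp
    hence "(\<Sum>f\<in>?U. w f * w f) = 0"
      by (subst (asm) sum.swap) (simp add: w_def sum_distrib_right)
    hence w0: "\<forall>f\<in>?U. w f = 0"
      using finU by (subst (asm) sum_nonneg_eq_0_iff) auto
    have "D (\<lambda>p. restrict u A (\<rho> p)) = 1" if "\<rho> \<in> R" for \<rho>
    proof -
      have "D (\<lambda>p. restrict u A (\<rho> p)) = D u"
        using that by (intro D_cong) (auto simp: R_def permutes_in_image)
      thus ?thesis by (simp add: D_def rel_sign_refl[OF inj])
    qed
    hence "w (restrict u A) = int (card R)" by (simp add: w_def)
    moreover have "id \<in> R" by (simp add: R_def permutes_id)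
    hence "card R > 0" using finR by (auto simp: card_gt_0_iff)
    moreover have "restrict u A \<in> ?U" using u_less by auto
    ultimately show False using w0 by force
  qed
  ultimately have "I u = 0" by simp
  let ?G = "\<lambda>f \<alpha>. if \<forall>p\<in>A. f p = u p then C \<alpha> else 0"
  have "(\<Sum>\<pi> | \<pi> permutes A. sign \<pi> * ?G (\<lambda>p. u (\<pi> p)) (\<lambda>p. v (\<pi> p)))
      = (\<Sum>f\<in>?U. \<Sum>\<alpha>\<in>A \<rightarrow>\<^sub>E L. grid_sign f \<alpha> * ?G f \<alpha>)"
  proof (rule sum_grid_sign_pairs[symmetric])
    fix f f' :: "'a \<Rightarrow> nat" and \<alpha> \<alpha>' :: "'a \<Rightarrow> 'l"
    assume "\<And>p. p \<in> A \<Longrightarrow> f p = f' p" and \<alpha>: "\<And>p. p \<in> A \<Longrightarrow> \<alpha> p = \<alpha>' p"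
    thus "?G f \<alpha> = ?G f' \<alpha>'" using C_cong[OF \<alpha>] by simp
  qed
  also have "\<dots> = (\<Sum>f\<in>?U. if f = restrict u A then I u else 0)"
  proof (rule sum.cong[OF refl])
    fix f assume f: "f \<in> ?U"
    have iff: "(\<forall>p\<in>A. f p = u p) \<longleftrightarrow> f = restrict u A"
      using f by (auto simp: fun_eq_iff restrict_def PiE_def extensional_def)
    have "grid_sign f \<alpha> = grid_sign u \<alpha>" if "f = restrict u A" for \<alpha>
      using that by (intro rel_sign_cong) simp
    thus "(\<Sum>\<alpha>\<in>A \<rightarrow>\<^sub>E L. grid_sign f \<alpha> * ?G f \<alpha>) = (if f = restrict u A then I u else 0)"
      unfolding iff by (simp add: I_def)
  qed
  also have "\<dots> = 0" using \<open>I u = 0\<close> by (intro sum.neutral) simp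
  finally show ?thesis .
qed

end

section \<open>Nonvanishing\<close>

text \<open>
  A permutation of the labels inside the slices is exchanged for a permutation of the slice indices; this
  turns slice signs into products of row determinants.
\<close>

lemma (in grid) grid_sign_transfer:
  assumes \<sigma>: "\<sigma> permutes A"
  shows "grid_sign u (\<lambda>p. v (\<sigma> p)) = sign \<sigma> * grid_sign (\<lambda>p. u (inv_into UNIV \<sigma> p)) v"
  using rel_sign_permute[OF finite_A inj \<sigma>, of "\<lambda>p. (u (inv_into UNIV \<sigma> p), v p)"]
  by (simp add: permutes_inverses[OF \<sigma>])

lemma pair_code_decode:
  assumes "p \<in> cube n"
  shows "(n * x_coord p + y_coord p) div n = x_coord p" "(n * x_coord p + y_coord p) mod n = y_coord p"
    "(n * x_coord p + z_coord p) div n = x_coord p" "(n * x_coord p + z_coord p) mod n = z_coord p"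
    "(n * y_coord p + z_coord p) div n = y_coord p" "(n * y_coord p + z_coord p) mod n = z_coord p"
    "y_coord p mod n = y_coord p" "z_coord p mod n = z_coord p"
  using assms by (auto simp: cube_def)

text \<open>
  The numbering of a slice encodes the two remaining coordinates as \<open>n * i + j\<close>, so each of them can be
  read off a label by \<open>div\<close> and \<open>mod\<close>. This is how the factors belonging to the other two directions become
  a function \<open>C\<close> of the labeling in \<open>stabilizer_sum_eq_0\<close>.
\<close>

lemma F_nonzero:
  assumes r: "linear_order_on (cube n) r"
  shows "\<exists>w\<in>tensors (n\<^sup>2). F r n w \<noteq> 0"
proof (rule ccontr)
  assume "\<not> ?thesis"
  hence F0: "F r n w = 0" if "w \<in> tensors (n\<^sup>2)" for w using that by blast
  let ?C = "cube n" and ?L = "labelings n"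
  let ?vx = "\<lambda>p. n * y_coord p + z_coord p"
  let ?vy = "\<lambda>p. n * x_coord p + z_coord p"
  let ?vz = "\<lambda>p. n * x_coord p + y_coord p"
  interpret X: grid ?C x_coord ?vx n "{..<n\<^sup>2}" by (rule grid_x)
  interpret Y: grid ?C y_coord ?vy n "{..<n\<^sup>2}" by (rule grid_y)
  interpret Z: grid ?C z_coord ?vz n "{..<n\<^sup>2}" by (rule grid_z)
  let ?Dx = "\<lambda>f. X.grid_sign f ?vx" and ?Dy = "\<lambda>f. Y.grid_sign f ?vy" and ?Dz = "\<lambda>f. Z.grid_sign f ?vz"
  let ?Sym = "{\<pi>. \<pi> permutes ?C}"
  have Dy_cong: "?Dy f = ?Dy f'" if "\<And>p. p \<in> ?C \<Longrightarrow> f p = f' p" for f f'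
    using that by (intro rel_sign_cong) simp
  have Dz_cong: "?Dz f = ?Dz f'" if "\<And>p. p \<in> ?C \<Longrightarrow> f p = f' p" for f f'
    using that by (intro rel_sign_cong) simp
  have in_C: "\<pi> p \<in> ?C" if "\<pi> permutes ?C" "p \<in> ?C" for \<pi> p
    using that by (simp add: permutes_in_image)

  obtain \<epsilon>x where \<epsilon>x: "\<epsilon>x * \<epsilon>x = 1" "\<And>\<alpha>. sgn_x r n \<alpha> = \<epsilon>x * X.grid_sign x_coord \<alpha>"
    using slices_sgn_eq_rel_sign[OF r grid_x slices_eq(1)] unfolding sgn_x_def by blast
  obtain \<epsilon>y where \<epsilon>y: "\<epsilon>y * \<epsilon>y = 1" "\<And>\<alpha>. sgn_y r n \<alpha> = \<epsilon>y * Y.grid_sign y_coord \<alpha>"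
    using slices_sgn_eq_rel_sign[OF r grid_y slices_eq(2)] unfolding sgn_y_def by blast
  obtain \<epsilon>z where \<epsilon>z: "\<epsilon>z * \<epsilon>z = 1" "\<And>\<alpha>. sgn_z r n \<alpha> = \<epsilon>z * Z.grid_sign z_coord \<alpha>"
    using slices_sgn_eq_rel_sign[OF r grid_z slices_eq(3)] unfolding sgn_z_def by blast

  \<comment> \<open>the coefficients of \<open>F\<close> at the monomials whose labelings are permuted reference labelings\<close>
  have coefficient: "(\<Sum>\<pi>\<in>?Sym. sgn_x r n (\<lambda>p. ?vx (\<sigma>1 (\<pi> p))) * sgn_y r n (\<lambda>p. ?vy (\<sigma>2 (\<pi> p)))
      * sgn_z r n (\<lambda>p. ?vz (\<sigma>3 (\<pi> p)))) = 0"
    if \<sigma>: "\<sigma>1 permutes ?C" "\<sigma>2 permutes ?C" "\<sigma>3 permutes ?C" for \<sigma>1 \<sigma>2 \<sigma>3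
  proof -
    let ?T = "?L \<times> ?L \<times> ?L"
    let ?key = "\<lambda>(\<alpha>, \<beta>, \<gamma>) p. (\<alpha> p, \<beta> p, \<gamma> p) :: nat \<times> nat \<times> nat"
    let ?c = "\<lambda>(\<alpha>, \<beta>, \<gamma>). complex_of_int (sgn_x r n \<alpha> * sgn_y r n \<beta> * sgn_z r n \<gamma>)"
    let ?h = "\<lambda>p. (?vx (\<sigma>1 p), ?vy (\<sigma>2 p), ?vz (\<sigma>3 p))"
    let ?t = "\<lambda>\<pi>. (restrict (\<lambda>p. ?vx (\<sigma>1 (\<pi> p))) ?C, restrict (\<lambda>p. ?vy (\<sigma>2 (\<pi> p))) ?C,
      restrict (\<lambda>p. ?vz (\<sigma>3 (\<pi> p))) ?C)"
    have finT: "finite ?T"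
      unfolding labelings_def by (intro finite_cartesian_product finite_PiE X.finite_A) auto
    have vanish: "(\<Sum>t\<in>?T. ?c t * (\<Prod>p\<in>?C. g (?key t p))) = 0" for g
    proof -
      define w :: tensor where
        "w = (\<lambda>a b c. if a < n\<^sup>2 \<and> b < n\<^sup>2 \<and> c < n\<^sup>2 then g (a, b, c) else 0)"
      have "(\<Prod>p\<in>?C. w (\<alpha> p) (\<beta> p) (\<gamma> p)) = (\<Prod>p\<in>?C. g (\<alpha> p, \<beta> p, \<gamma> p))"
        if "\<alpha> \<in> ?L" "\<beta> \<in> ?L" "\<gamma> \<in> ?L" for \<alpha> \<beta> \<gamma>
        using that by (intro prod.cong refl) (auto simp: w_def labelings_def PiE_def Pi_def)
      hence "(\<Sum>t\<in>?T. ?c t * (\<Prod>p\<in>?C. g (?key t p))) = F r n w"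
        unfolding sum_triples F_def by (intro sum.cong refl) simp
      also have "\<dots> = 0" by (rule F0) (simp add: w_def tensors_def)
      finally show ?thesis .
    qed
    have "0 = (\<Sum>\<pi>\<in>?Sym. \<Sum>t\<in>?T. if \<forall>p\<in>?C. ?key t p = ?h (\<pi> p) then ?c t else 0)"
      by (rule vanishing_permuted_key[where T = ?T and key = ?key and c = ?c and h = ?h,
            OF finT X.finite_A vanish, symmetric])
    also have "\<dots> = (\<Sum>\<pi>\<in>?Sym. ?c (?t \<pi>))"
    proof (rule sum.cong[OF refl])
      fix \<pi> assume "\<pi> \<in> ?Sym"
      hence \<pi>: "\<pi> permutes ?C" by simp
      have t: "?t \<pi> \<in> ?T"
        unfolding labelings_def
        using X.v_in[OF in_C[OF \<sigma>(1) in_C[OF \<pi>]]] Y.v_in[OF in_C[OF \<sigma>(2) in_C[OF \<pi>]]]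
          Z.v_in[OF in_C[OF \<sigma>(3) in_C[OF \<pi>]]]
        by (intro SigmaI restrict_PiE_iff[THEN iffD2] ballI)
      have "(\<forall>p\<in>?C. ?key t p = ?h (\<pi> p)) \<longleftrightarrow> t = ?t \<pi>" if t: "t \<in> ?T" for t
      proof -
        obtain \<alpha> \<beta> \<gamma> where [simp]: "t = (\<alpha>, \<beta>, \<gamma>)" by (rule prod_cases3)
        have ext: "(\<forall>p\<in>?C. f p = k p) \<longleftrightarrow> f = restrict k ?C" if "f \<in> ?L" for f k :: "nat \<times> nat \<times> nat \<Rightarrow> nat"
          using that by (auto simp: labelings_def fun_eq_iff restrict_def PiE_def extensional_def)
        have mem: "\<alpha> \<in> ?L" "\<beta> \<in> ?L" "\<gamma> \<in> ?L" using t by simp_all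
        have "(\<forall>p\<in>?C. ?key t p = ?h (\<pi> p)) \<longleftrightarrow> (\<forall>p\<in>?C. \<alpha> p = ?vx (\<sigma>1 (\<pi> p)))
            \<and> (\<forall>p\<in>?C. \<beta> p = ?vy (\<sigma>2 (\<pi> p))) \<and> (\<forall>p\<in>?C. \<gamma> p = ?vz (\<sigma>3 (\<pi> p)))"
          by (simp add: ball_conj_distrib)
        also have "\<dots> \<longleftrightarrow> t = ?t \<pi>"
          unfolding ext[OF mem(1)] ext[OF mem(2)] ext[OF mem(3)] by simp
        finally show ?thesis .
      qed
      hence "(\<Sum>t\<in>?T. if \<forall>p\<in>?C. ?key t p = ?h (\<pi> p) then ?c t else 0)
          = (\<Sum>t\<in>?T. if t = ?t \<pi> then ?c t else 0)"
        by (intro sum.cong refl if_cong)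
      also have "\<dots> = ?c (?t \<pi>)"
        by (simp only: sum.delta[OF finT] t if_True)
      finally show "(\<Sum>t\<in>?T. if \<forall>p\<in>?C. ?key t p = ?h (\<pi> p) then ?c t else 0) = ?c (?t \<pi>)" .
    qed
    also have "\<dots> = of_int (\<Sum>\<pi>\<in>?Sym. sgn_x r n (\<lambda>p. ?vx (\<sigma>1 (\<pi> p))) * sgn_y r n (\<lambda>p. ?vy (\<sigma>2 (\<pi> p)))
        * sgn_z r n (\<lambda>p. ?vz (\<sigma>3 (\<pi> p))))"
    proof -
      have "sgn_x r n (restrict \<alpha> ?C) = sgn_x r n \<alpha>" "sgn_y r n (restrict \<alpha> ?C) = sgn_y r n \<alpha>"
        "sgn_z r n (restrict \<alpha> ?C) = sgn_z r n \<alpha>" for \<alpha>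
        unfolding \<epsilon>x(2) \<epsilon>y(2) \<epsilon>z(2) by (rule arg_cong[where f = "(*) _"], rule rel_sign_cong, simp)+
      thus ?thesis by (simp only: prod.case of_int_sum)
    qed
    finally show ?thesis
      by (rule of_int_eq_0_iff[where 'a = complex, THEN iffD1, OF sym])
  qed

  have orth: "(\<Sum>\<pi>\<in>?Sym. sign \<pi> * (?Dx (\<lambda>p. x_coord (\<pi> (\<rho>1 p))) * ?Dy (\<lambda>p. y_coord (\<pi> (\<rho>2 p)))
      * ?Dz (\<lambda>p. z_coord (\<pi> (\<rho>3 p))))) = 0"
    if \<rho>: "\<rho>1 permutes ?C" "\<rho>2 permutes ?C" "\<rho>3 permutes ?C" for \<rho>1 \<rho>2 \<rho>3
  proof -
    let ?i = "inv_into UNIV :: (nat \<times> nat \<times> nat \<Rightarrow> nat \<times> nat \<times> nat) \<Rightarrow> _"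
    \<comment> \<open>the coefficient for the inverses of the \<open>\<rho>\<^sub>i\<close>; the sum is reindexed by \<open>\<pi> \<mapsto> \<pi>\<^sup>-\<^sup>1\<close>\<close>
    let ?k = "\<epsilon>x * \<epsilon>y * \<epsilon>z * (sign \<rho>1 * sign \<rho>2 * sign \<rho>3)"
    let ?s = "\<lambda>\<pi>. sign \<pi> * (?Dx (\<lambda>p. x_coord (\<pi> (\<rho>1 p))) * ?Dy (\<lambda>p. y_coord (\<pi> (\<rho>2 p)))
        * ?Dz (\<lambda>p. z_coord (\<pi> (\<rho>3 p))))"
    have perm: "sign (?i \<rho> \<circ> \<pi>) = sign \<rho> * sign \<pi>" "?i \<rho> \<circ> \<pi> permutes ?C" "?i (?i \<rho> \<circ> \<pi>) = ?i \<pi> \<circ> \<rho>"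
      if "\<rho> permutes ?C" "\<pi> permutes ?C" for \<rho> \<pi>
    proof -
      have "permutation \<rho>" "permutation \<pi>"
        using that X.finite_A by (auto intro: permutes_imp_permutation)
      thus "sign (?i \<rho> \<circ> \<pi>) = sign \<rho> * sign \<pi>"
        by (simp add: sign_compose sign_inverse permutation_inverse)
      show "?i \<rho> \<circ> \<pi> permutes ?C" using that by (intro permutes_compose permutes_inv)
      have "?i (?i \<rho> \<circ> \<pi>) = ?i \<pi> \<circ> ?i (?i \<rho>)"
        using that by (intro o_inv_distrib permutes_bij permutes_inv)
      thus "?i (?i \<rho> \<circ> \<pi>) = ?i \<pi> \<circ> \<rho>"
        using that by (simp add: inv_inv_eq permutes_bij)
    qed
    have "sgn_x r n (\<lambda>p. ?vx (?i \<rho>1 (\<pi> p))) * sgn_y r n (\<lambda>p. ?vy (?i \<rho>2 (\<pi> p)))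
        * sgn_z r n (\<lambda>p. ?vz (?i \<rho>3 (\<pi> p))) = ?k * ?s (?i \<pi>)" if \<pi>: "\<pi> permutes ?C" for \<pi>
    proof -
      \<comment> \<open>each direction contributes one factor \<open>sign \<pi>\<close>, and three of them amount to one\<close>
      have s: "sign (?i \<pi>) = sign \<pi> * sign \<pi> * sign \<pi>"
        using sign_inverse permutes_imp_permutation[OF X.finite_A \<pi>] by simp
      have "sgn_x r n (\<lambda>p. ?vx (?i \<rho>1 (\<pi> p))) = \<epsilon>x * (sign \<rho>1 * sign \<pi>) * ?Dx (\<lambda>p. x_coord (?i \<pi> (\<rho>1 p)))"
        using X.grid_sign_transfer[OF perm(2)[OF \<rho>(1) \<pi>]] by (simp add: \<epsilon>x perm[OF \<rho>(1) \<pi>])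
      moreover have "sgn_y r n (\<lambda>p. ?vy (?i \<rho>2 (\<pi> p))) = \<epsilon>y * (sign \<rho>2 * sign \<pi>) * ?Dy (\<lambda>p. y_coord (?i \<pi> (\<rho>2 p)))"
        using Y.grid_sign_transfer[OF perm(2)[OF \<rho>(2) \<pi>]] by (simp add: \<epsilon>y perm[OF \<rho>(2) \<pi>])
      moreover have "sgn_z r n (\<lambda>p. ?vz (?i \<rho>3 (\<pi> p))) = \<epsilon>z * (sign \<rho>3 * sign \<pi>) * ?Dz (\<lambda>p. z_coord (?i \<pi> (\<rho>3 p)))"
        using Z.grid_sign_transfer[OF perm(2)[OF \<rho>(3) \<pi>]] by (simp add: \<epsilon>z perm[OF \<rho>(3) \<pi>])
      ultimately show ?thesis unfolding s by (simp only: mult_ac)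
    qed
    hence "(\<Sum>\<pi>\<in>?Sym. sgn_x r n (\<lambda>p. ?vx (?i \<rho>1 (\<pi> p))) * sgn_y r n (\<lambda>p. ?vy (?i \<rho>2 (\<pi> p)))
        * sgn_z r n (\<lambda>p. ?vz (?i \<rho>3 (\<pi> p)))) = (\<Sum>\<pi>\<in>?Sym. ?k * ?s (?i \<pi>))"
      by (intro sum.cong refl) blast
    also have "\<dots> = ?k * (\<Sum>\<pi>\<in>?Sym. ?s \<pi>)"
      unfolding sum_distrib_left by (rule sum_permutations_inverse[symmetric])
    finally have "?k * (\<Sum>\<pi>\<in>?Sym. ?s \<pi>) = 0"
      using coefficient[OF \<rho>[THEN permutes_inv]] by simp
    moreover have "\<epsilon>x \<noteq> 0" "\<epsilon>y \<noteq> 0" "\<epsilon>z \<noteq> 0" using \<epsilon>x(1) \<epsilon>y(1) \<epsilon>z(1) by auto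
    ultimately show ?thesis by simp
  qed

  \<comment> \<open>the three factors are now removed in turn, each at the cost of fixing one coordinate of \<open>\<pi>\<close>\<close>
  have orth_yz: "(\<Sum>\<pi>\<in>?Sym. sign \<pi> * (if \<forall>p\<in>?C. x_coord (\<pi> p) = x_coord p
      then ?Dy (\<lambda>p. y_coord (\<pi> (\<rho>2 p))) * ?Dz (\<lambda>p. z_coord (\<pi> (\<rho>3 p))) else 0)) = 0"
    if \<rho>: "\<rho>2 permutes ?C" "\<rho>3 permutes ?C" for \<rho>2 \<rho>3
  proof -
    define C where "C = (\<lambda>\<alpha>. ?Dy (\<lambda>p. \<alpha> (\<rho>2 p) div n) * ?Dz (\<lambda>p. \<alpha> (\<rho>3 p) mod n))"
    have C: "C (\<lambda>p. ?vx (\<pi> p)) = ?Dy (\<lambda>p. y_coord (\<pi> (\<rho>2 p))) * ?Dz (\<lambda>p. z_coord (\<pi> (\<rho>3 p)))"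
      if "\<pi> permutes ?C" for \<pi>
      unfolding C_def using that \<rho>
      by (intro arg_cong2[where f = "(*)"] Dy_cong Dz_cong) (simp_all add: pair_code_decode in_C)
    have "(\<Sum>\<pi>\<in>?Sym. sign \<pi> * (if \<forall>p\<in>?C. x_coord (\<pi> p) = x_coord p then C (\<lambda>p. ?vx (\<pi> p)) else 0)) = 0"
    proof (rule X.stabilizer_sum_eq_0)
      show "C \<alpha> = C \<alpha>'" if "\<And>p. p \<in> ?C \<Longrightarrow> \<alpha> p = \<alpha>' p" for \<alpha> \<alpha>'
        unfolding C_def using that \<rho> by (intro arg_cong2[where f = "(*)"] Dy_cong Dz_cong) (simp_all add: in_C)
      show "(\<Sum>\<pi>\<in>?Sym. sign \<pi> * (C (\<lambda>p. ?vx (\<pi> p)) * ?Dx (\<lambda>p. x_coord (\<pi> (\<rho> p))))) = 0"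
        if "\<rho> permutes ?C" for \<rho>
        by (rule trans[OF sum.cong[OF refl] orth[OF that \<rho>]]) (simp add: C mult_ac)
    qed
    thus ?thesis
      by (rule trans[OF sum.cong[OF refl], rotated]) (simp add: C)
  qed

  have orth_z: "(\<Sum>\<pi>\<in>?Sym. sign \<pi> * (if \<forall>p\<in>?C. y_coord (\<pi> p) = y_coord p
      then if \<forall>p\<in>?C. x_coord (\<pi> p) = x_coord p then ?Dz (\<lambda>p. z_coord (\<pi> (\<rho>3 p))) else 0 else 0)) = 0"
    if \<rho>: "\<rho>3 permutes ?C" for \<rho>3
  proof -
    define C where "C = (\<lambda>\<alpha>. if \<forall>p\<in>?C. \<alpha> p div n = x_coord p then ?Dz (\<lambda>p. \<alpha> (\<rho>3 p) mod n) else 0)"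
    have C: "C (\<lambda>p. ?vy (\<pi> p)) = (if \<forall>p\<in>?C. x_coord (\<pi> p) = x_coord p then ?Dz (\<lambda>p. z_coord (\<pi> (\<rho>3 p))) else 0)"
      if "\<pi> permutes ?C" for \<pi>
      unfolding C_def using that \<rho> by (intro if_cong Dz_cong) (simp_all add: pair_code_decode in_C)
    have "(\<Sum>\<pi>\<in>?Sym. sign \<pi> * (if \<forall>p\<in>?C. y_coord (\<pi> p) = y_coord p then C (\<lambda>p. ?vy (\<pi> p)) else 0)) = 0"
    proof (rule Y.stabilizer_sum_eq_0)
      show "C \<alpha> = C \<alpha>'" if "\<And>p. p \<in> ?C \<Longrightarrow> \<alpha> p = \<alpha>' p" for \<alpha> \<alpha>'
        unfolding C_def using that \<rho> by (intro if_cong Dz_cong) (simp_all add: in_C)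
      show "(\<Sum>\<pi>\<in>?Sym. sign \<pi> * (C (\<lambda>p. ?vy (\<pi> p)) * ?Dy (\<lambda>p. y_coord (\<pi> (\<rho> p))))) = 0"
        if "\<rho> permutes ?C" for \<rho>
      proof -
        have "(\<Sum>\<pi>\<in>?Sym. sign \<pi> * (C (\<lambda>p. ?vy (\<pi> p)) * ?Dy (\<lambda>p. y_coord (\<pi> (\<rho> p)))))
          = (\<Sum>\<pi>\<in>?Sym. sign \<pi> * (if \<forall>p\<in>?C. x_coord (\<pi> p) = x_coord p
              then ?Dy (\<lambda>p. y_coord (\<pi> (\<rho> p))) * ?Dz (\<lambda>p. z_coord (\<pi> (\<rho>3 p))) else 0))"
          by (intro sum.cong refl) (simp add: C)
        thus ?thesis using orth_yz[OF that \<rho>] by simp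
      qed
    qed
    thus ?thesis
      by (rule trans[OF sum.cong[OF refl], rotated]) (simp add: C)
  qed

  define C where "C = (\<lambda>\<alpha>. if \<forall>p\<in>?C. \<alpha> p div n = x_coord p \<and> \<alpha> p mod n = y_coord p then 1 else 0 :: int)"
  have C: "C (\<lambda>p. ?vz (\<pi> p)) = (if \<forall>p\<in>?C. x_coord (\<pi> p) = x_coord p \<and> y_coord (\<pi> p) = y_coord p then 1 else 0)"
    if "\<pi> permutes ?C" for \<pi>
    unfolding C_def using that by (intro if_cong) (simp_all add: pair_code_decode in_C)
  have total: "(\<Sum>\<pi>\<in>?Sym. sign \<pi> * (if \<forall>p\<in>?C. z_coord (\<pi> p) = z_coord p then C (\<lambda>p. ?vz (\<pi> p)) else 0)) = 0"
  proof (rule Z.stabilizer_sum_eq_0)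
    show "C \<alpha> = C \<alpha>'" if "\<And>p. p \<in> ?C \<Longrightarrow> \<alpha> p = \<alpha>' p" for \<alpha> \<alpha>'
      unfolding C_def using that by (intro if_cong) simp_all
    show "(\<Sum>\<pi>\<in>?Sym. sign \<pi> * (C (\<lambda>p. ?vz (\<pi> p)) * ?Dz (\<lambda>p. z_coord (\<pi> (\<rho> p))))) = 0"
      if "\<rho> permutes ?C" for \<rho>
    proof -
      have "(\<Sum>\<pi>\<in>?Sym. sign \<pi> * (C (\<lambda>p. ?vz (\<pi> p)) * ?Dz (\<lambda>p. z_coord (\<pi> (\<rho> p)))))
        = (\<Sum>\<pi>\<in>?Sym. sign \<pi> * (if \<forall>p\<in>?C. y_coord (\<pi> p) = y_coord p
            then if \<forall>p\<in>?C. x_coord (\<pi> p) = x_coord p then ?Dz (\<lambda>p. z_coord (\<pi> (\<rho> p))) else 0 else 0))"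
        by (intro sum.cong refl) (auto simp: C)
      thus ?thesis using orth_z[OF that] by simp
    qed
  qed
  have summand: "sign \<pi> * (if \<forall>p\<in>?C. z_coord (\<pi> p) = z_coord p then C (\<lambda>p. ?vz (\<pi> p)) else 0)
      = (if \<pi> = id then 1 else 0)" if \<pi>: "\<pi> permutes ?C" for \<pi>
  proof (cases "\<pi> = id")
    case True
    thus ?thesis using C[OF \<pi>] by simp
  next
    case False
    then obtain p where p: "\<pi> p \<noteq> p" by (auto simp: fun_eq_iff)
    hence "p \<in> ?C" using permutes_not_in[OF \<pi>] by blast
    moreover have "x_coord (\<pi> p) \<noteq> x_coord p \<or> y_coord (\<pi> p) \<noteq> y_coord p \<or> z_coord (\<pi> p) \<noteq> z_coord p"
      using p by (metis prod.collapse)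
    ultimately have "\<not> (\<forall>p\<in>?C. z_coord (\<pi> p) = z_coord p) \<or> C (\<lambda>p. ?vz (\<pi> p)) = 0"
      using C[OF \<pi>] by auto
    thus ?thesis using False by auto
  qed
  have "(\<Sum>\<pi>\<in>?Sym. if \<pi> = id then 1 else (0 :: int)) = 0"
    by (rule trans[OF sum.cong[OF refl] total]) (simp only: summand mem_Collect_eq)
  thus False
    using finite_permutations[OF X.finite_A] by (simp add: sum.delta permutes_id)
qed

theorem theorem5p13:
  fixes n :: nat
    and r :: "((nat \<times> nat \<times> nat) \<times> (nat \<times> nat \<times> nat)) set"
  assumes "n \<ge> 1"
    and "linear_order_on (cube n) r"
  shows "(\<forall>g1 \<in> carrier_mat (n\<^sup>2) (n\<^sup>2). \<forall>g2 \<in> carrier_mat (n\<^sup>2) (n\<^sup>2).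
            \<forall>g3 \<in> carrier_mat (n\<^sup>2) (n\<^sup>2). \<forall>w \<in> tensors (n\<^sup>2).
              invertible_mat g1 \<and> invertible_mat g2 \<and> invertible_mat g3 \<longrightarrow>
              F r n (tensor_act (n\<^sup>2) g1 g2 g3 w) = (det g1 * det g2 * det g3) ^ n * F r n w)
         \<and> (\<exists>w \<in> tensors (n\<^sup>2). F r n w \<noteq> 0)"
  using F_tensor_act[OF assms(2)] F_nonzero[OF assms(2)] by blast

end
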